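(* Let $n\geq 1$ and $\nu\geq 1$ be integers, let $p\in(1,\infty)$, and let $u$ be a pluriharmonic function of $\mathbb{B}_{\ell_2^n}$ into $\mathbf{B}_{\ell_p^\nu}$ (so $u$ is $\mathbb{R}^\nu$-valued). Then for every $z\in\mathbb{B}_{\ell_2^n}$, $$\big|\nabla\|u(z)\|_p\big|\leq\frac{4}{\pi}\,\frac{1-\|u(z)\|_p^2}{1-\|z\|_2^2}.$$ This inequality is sharp for each $z$ (that is, for each $z\in\mathbb{B}_{\ell_2^n}$ there is such a $u$ for which equality holds at $z$).
   Context: For $p\in[1,\infty)$, $\|z\|_p=(\sum_j|z_j|^p)^{1/p}$. $\mathbb{B}_{\ell_p^n}=\{z\in\mathbb{C}^n:\|z\|_p<1\}$ and $\mathbf{B}_{\ell_p^\nu}=\{x\in\mathbb{R}^\nu:\|x\|_p<1\}$. A twice continuously differentiable complex-valued function $f$ on a domain $\Omega\subset\mathbb{C}^n$ is pluriharmonic if for each fixed $z\in\Omega$ and $\theta\in\mathbb{C}^n$ with $\|\theta\|_2=1$, the function $\zeta\mapsto f(z+\zeta\theta)$ is harmonic in $\{\zeta\in\mathbb{C}:|\zeta|<d_\Omega(z)\}$, where $d_\Omega(z)$ is the Euclidean distance from $z$ to $\partial\Omega$; a vector-valued map is pluriharmonic if each component is. For a differentiable (in the real sense) map $u$, $$\big|\nabla\|u(z)\|_p\big|:=\limsup_{w\to z}\frac{\big|\|u(z)\|_p-\|u(w)\|_p\big|}{\|z-w\|_2}.$$ *)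

theory Defs
  imports "HOL-Analysis.Analysis"
begin

definition lp_norm :: "real \<Rightarrow> 'a::real_normed_vector ^ 'k \<Rightarrow> real"
  where "lp_norm p x = (\<Sum>j\<in>UNIV. norm (x $ j) powr p) powr (1 / p)"

definition lp_unit_ball :: "real \<Rightarrow> ('a::real_normed_vector ^ 'k) set"
  where "lp_unit_ball p = {x. lp_norm p x < 1}"

text \<open>The Euclidean case is the library norm, which is used wherever \<open>p = 2\<close>.\<close>

lemma lp_norm_2: "lp_norm 2 x = norm x"
  by (simp add: lp_norm_def norm_vec_def L2_set_def powr_half_sqrt sum_nonneg)

lemma lp_unit_ball_2: "lp_unit_ball 2 = ball 0 1"
  by (auto simp: lp_unit_ball_def lp_norm_2)

text \<open>\<open>second_derivs_on S f f' f''\<close>: \<open>f\<close> is twice continuously differentiable, in the real sense,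
  on the open set \<open>S\<close>, with first and second Frechet derivatives \<open>f'\<close> and \<open>f''\<close>.\<close>

definition second_derivs_on ::
  "'a::real_normed_vector set \<Rightarrow> ('a \<Rightarrow> 'b::real_normed_vector) \<Rightarrow>
    ('a \<Rightarrow> 'a \<Rightarrow>\<^sub>L 'b) \<Rightarrow> ('a \<Rightarrow> 'a \<Rightarrow>\<^sub>L 'a \<Rightarrow>\<^sub>L 'b) \<Rightarrow> bool"
  where "second_derivs_on S f f' f'' \<longleftrightarrow>
    open S \<and>
    (\<forall>x\<in>S. (f has_derivative blinfun_apply (f' x)) (at x)) \<and>
    (\<forall>x\<in>S. (f' has_derivative blinfun_apply (f'' x)) (at x)) \<and>
    continuous_on S f''"

definition C2_on :: "'a::real_normed_vector set \<Rightarrow> ('a \<Rightarrow> 'b::real_normed_vector) \<Rightarrow> bool"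
  where "C2_on S f \<longleftrightarrow> (\<exists>f' f''. second_derivs_on S f f' f'')"

text \<open>The Laplacian is the trace of the second derivative; for a function of a complex variable,
  where \<open>Basis = {1, \<i>}\<close>, it is the sum of the second partial derivatives in \<open>x\<close> and \<open>y\<close>.\<close>

definition harmonic_on :: "'a::euclidean_space set \<Rightarrow> ('a \<Rightarrow> 'b::real_normed_vector) \<Rightarrow> bool"
  where "harmonic_on S f \<longleftrightarrow>
    (\<exists>f' f''. second_derivs_on S f f' f'' \<and>
       (\<forall>x\<in>S. (\<Sum>b\<in>Basis. blinfun_apply (blinfun_apply (f'' x) b) b) = 0))"

text \<open>Extended-real valued, so that the distance to an empty boundary is \<open>\<infinity>\<close>
  (\<open>infdist\<close> would give 0).\<close>

definition boundary_dist :: "'a::metric_space set \<Rightarrow> 'a \<Rightarrow> ereal"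
  where "boundary_dist S z = (INF w\<in>frontier S. ereal (dist z w))"

definition pluriharmonic_on :: "(complex ^ 'n) set \<Rightarrow> (complex ^ 'n \<Rightarrow> complex) \<Rightarrow> bool"
  where "pluriharmonic_on S f \<longleftrightarrow>
    C2_on S f \<and>
    (\<forall>z\<in>S. \<forall>\<theta>. norm \<theta> = 1 \<longrightarrow>
       harmonic_on {\<zeta>. ereal (norm \<zeta>) < boundary_dist S z} (\<lambda>\<zeta>. f (z + \<zeta> *s \<theta>)))"

definition pluriharmonic_map_on ::
  "(complex ^ 'n) set \<Rightarrow> (complex ^ 'n \<Rightarrow> real ^ 'm) \<Rightarrow> bool"
  where "pluriharmonic_map_on S u \<longleftrightarrow>
    (\<forall>i. pluriharmonic_on S (\<lambda>z. complex_of_real (u z $ i)))"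

definition grad_lp_norm ::
  "real \<Rightarrow> ('a::real_normed_vector \<Rightarrow> real ^ 'm) \<Rightarrow> 'a \<Rightarrow> ereal"
  where "grad_lp_norm p u z =
    Limsup (at z) (\<lambda>w. ereal (\<bar>lp_norm p (u z) - lp_norm p (u w)\<bar> / norm (z - w)))"

end

theory Submission
  imports Defs "HOL-Complex_Analysis.Complex_Analysis"
begin

text \<open>
  The whole theorem rests on one holomorphic fact in one variable: if \<open>F\<close> maps a disc of centre
  \<open>c\<close> and radius \<open>r\<close> into the strip \<open>\<bar>Re w\<bar> < 1\<close>, then
  \<open>\<bar>F' a\<bar> \<le> (4 / \<pi>) cos (\<pi> Re F(a) / 2) r / (r\<^sup>2 - \<bar>a - c\<bar>\<^sup>2)\<close>.  This is the Schwarz lemma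
  conjugated by the conformal maps of the strip onto a half plane and of the half plane onto a disc
  (\<open>strip_Schwarz_Pick\<close>), and the elementary bound \<open>cos (\<pi> t / 2) \<le> 1 - t\<^sup>2\<close>
  (\<open>cos_half_pi_le\<close>) turns it into the form needed here.

  A real pluriharmonic function \<open>v\<close> with \<open>\<bar>v\<bar> < 1\<close> on the ball is reduced to this fact by cutting
  with a complex line through \<open>z\<close> in a unit direction \<open>\<theta>\<close>.  The slice is again a disc, though not
  centred at \<open>z\<close>, and \<open>v\<close> restricted to it is the real part of a holomorphic \<open>F\<close>
  (\<open>harmonic_real_part_of_holomorphic\<close>).  If \<open>s\<close> is the Hermitian product of \<open>z\<close> and \<open>\<theta>\<close>, the
  slice has \<open>r\<^sup>2 = 1 - \<parallel>z\<parallel>\<^sup>2 + \<bar>s\<bar>\<^sup>2\<close> and \<open>z\<close> lies at distance \<open>\<bar>s\<bar>\<close> from its centre, so the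
  hyperbolic factor \<open>r / (r\<^sup>2 - \<bar>s\<bar>\<^sup>2)\<close> is at most \<open>1 / (1 - \<parallel>z\<parallel>\<^sup>2)\<close>.  This bounds every
  directional derivative of \<open>v\<close> by \<open>(4 / \<pi>) (1 - v(z)\<^sup>2) / (1 - \<parallel>z\<parallel>\<^sup>2)\<close>.

  For a vector-valued \<open>u\<close>, the functions \<open>v = l \<bullet> u\<close> with \<open>l\<close> in the dual unit ball are of this
  kind.  Choosing \<open>l\<close> to norm \<open>u w\<close> bounds the increment \<open>\<parallel>u w\<parallel>\<^sub>p - \<parallel>u z\<parallel>\<^sub>p\<close> by \<open>l \<bullet> (u w - u z)\<close>.
  As \<open>w\<close> tends to \<open>z\<close> the number \<open>l \<bullet> u z\<close> tends to \<open>\<parallel>u z\<parallel>\<^sub>p\<close>, so the limit superior obeys the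
  scalar bound (\<open>grad_lp_norm_le\<close>).  This argument works at zeros of \<open>u\<close> as well, where the norm
  is not differentiable.

  For sharpness write \<open>z = \<parallel>z\<parallel> e\<close> with a unit vector \<open>e\<close>, let \<open>\<omega>\<close> be the Hermitian product of
  the variable with \<open>e\<close>, and put \<open>U = (2 / \<pi>) Im Ln ((1 + \<omega>) / (1 - \<omega>))\<close> in one coordinate of
  \<open>u\<close> and \<open>0\<close> in the others.  The logarithm maps the disc conformally onto the strip
  \<open>\<bar>Im w\<bar> < \<pi> / 2\<close>, \<open>U\<close> vanishes on the real diameter, which contains the point \<open>\<omega> = \<parallel>z\<parallel>\<close>, and
  the derivative of \<open>U\<close> at \<open>z\<close> in the direction \<open>\<i> e\<close> is \<open>(4 / \<pi>) / (1 - \<parallel>z\<parallel>\<^sup>2)\<close>.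
\<close>

section \<open>Symmetry of second derivatives\<close>

text \<open>The second difference over the parallelogram spanned by \<open>t h\<close> and \<open>t k\<close> is the increment along
\<open>h\<close> of the difference along \<open>k\<close>.  The mean value theorem in the \<open>h\<close> direction rewrites it as a
difference of values of \<open>f'\<close> at two points that differ by \<open>t k\<close>, and differentiability of \<open>f'\<close> at
\<open>x\<close> turns that difference into \<open>t\<^sup>2 f'' k h\<close> up to \<open>o(t\<^sup>2)\<close>.\<close>

lemma second_difference_tendsto:
  fixes f :: "'a::real_normed_vector \<Rightarrow> real" and f'' :: "'a \<Rightarrow>\<^sub>L 'a \<Rightarrow>\<^sub>L real"
  assumes S: "open S" "x \<in> S"
    and f': "\<And>y. y \<in> S \<Longrightarrow> (f has_derivative blinfun_apply (f' y)) (at y)"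
    and f'': "(f' has_derivative blinfun_apply f'') (at x)"
  shows "((\<lambda>t. (f (x + t *\<^sub>R h + t *\<^sub>R k) - f (x + t *\<^sub>R h) - f (x + t *\<^sub>R k) + f x) / t\<^sup>2)
           \<longlongrightarrow> f'' k h) (at_right 0)"
proof (rule tendstoI)
  fix e :: real assume e: "e > 0"
  define C where "C = norm h + norm k + 1"
  have C: "C > 0" "norm h < C" "norm h + norm k \<le> C"
    unfolding C_def using norm_ge_zero[of h] norm_ge_zero[of k] by linarith+
  \<comment> \<open>With this choice the final error is \<open>2 \<eta> C \<parallel>h\<parallel> = e \<parallel>h\<parallel> / C < e\<close>.\<close>
  define \<eta> where "\<eta> = e / (2 * C * C)"
  have \<eta>: "\<eta> > 0" using e C by (simp add: \<eta>_def)
  obtain d1 where d1: "d1 > 0" "\<And>y. norm (y - x) < d1 \<Longrightarrow> norm (f' y - f' x - f'' (y - x)) \<le> \<eta> * norm (y - x)"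
    using f'' \<eta> unfolding has_derivative_at_alt by blast
  obtain d2 where d2: "d2 > 0" "ball x d2 \<subseteq> S"
    using S open_contains_ball by blast
  define d where "d = min d1 d2"
  have d: "d > 0" using d1 d2 by (simp add: d_def)
  have "dist ((f (x + t *\<^sub>R h + t *\<^sub>R k) - f (x + t *\<^sub>R h) - f (x + t *\<^sub>R k) + f x) / t\<^sup>2) (f'' k h) < e"
    if t: "0 < t" "t < d / C" for t
  proof -
    have tC: "t * C < d" using t C by (simp add: field_simps)
    have near: "norm ((s * t) *\<^sub>R h + r *\<^sub>R k) \<le> t * C" if "0 \<le> s" "s \<le> 1" "0 \<le> r" "r \<le> t" for s r
    proof -
      have "norm ((s * t) *\<^sub>R h + r *\<^sub>R k) \<le> (s * t) * norm h + r * norm k"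
        using norm_triangle_ineq[of "(s * t) *\<^sub>R h" "r *\<^sub>R k"] that t by simp
      also have "\<dots> \<le> t * norm h + t * norm k"
        using that t by (intro add_mono mult_right_mono) (auto simp: mult_left_le_one_le)
      also have "\<dots> \<le> t * C" using C t by (simp flip: distrib_left)
      finally show ?thesis .
    qed
    have inS: "x + (s * t) *\<^sub>R h + r *\<^sub>R k \<in> S" if "0 \<le> s" "s \<le> 1" "0 \<le> r" "r \<le> t" for s r
    proof -
      have "dist x (x + (s * t) *\<^sub>R h + r *\<^sub>R k) < d"
        using near[OF that] tC unfolding dist_norm norm_minus_commute[of x]
        by (simp add: add.assoc del: add.commute)
      then show ?thesis using d2 by (auto simp: d_def)
    qed
    define \<phi> where "\<phi> s = f (x + (s * t) *\<^sub>R h + t *\<^sub>R k) - f (x + (s * t) *\<^sub>R h + 0 *\<^sub>R k)" for s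
    define \<phi>' where "\<phi>' s = f' (x + (s * t) *\<^sub>R h + t *\<^sub>R k) (t *\<^sub>R h) - f' (x + (s * t) *\<^sub>R h + 0 *\<^sub>R k) (t *\<^sub>R h)" for s
    have part: "((\<lambda>s. f (x + (s * t) *\<^sub>R h + r *\<^sub>R k)) has_field_derivative
        f' (x + (s * t) *\<^sub>R h + r *\<^sub>R k) (t *\<^sub>R h)) (at s)"
      if "0 \<le> s" "s \<le> 1" "0 \<le> r" "r \<le> t" for s r
    proof -
      have "((\<lambda>s. x + (s * t) *\<^sub>R h + r *\<^sub>R k) has_derivative (\<lambda>u. (u * t) *\<^sub>R h)) (at s)"
        by (auto intro!: derivative_eq_intros)
      from has_derivative_compose[OF this f'[OF inS[OF that]]]
      show ?thesis
        unfolding has_field_derivative_def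
        by (rule has_derivative_eq_rhs)
           (simp add: fun_eq_iff blinfun.scaleR_right)
    qed
    have "DERIV \<phi> s :> \<phi>' s" if "0 \<le> s" "s \<le> 1" for s
      unfolding \<phi>_def \<phi>'_def using that t by (intro DERIV_diff part) auto
    then obtain s where s: "0 < s" "s < 1" "\<phi> 1 - \<phi> 0 = (1 - 0) * \<phi>' s"
      using MVT2[of 0 1 \<phi> \<phi>'] by auto
    define y1 where "y1 = x + (s * t) *\<^sub>R h + t *\<^sub>R k"
    define y2 where "y2 = x + (s * t) *\<^sub>R h + 0 *\<^sub>R k"
    have n1: "norm (y1 - x) \<le> t * C" and n2: "norm (y2 - x) \<le> t * C"
      using near[of s t] near[of s 0] s t unfolding y1_def y2_def by (auto simp: algebra_simps)
    \<comment> \<open>Both points lie within \<open>t C\<close> of \<open>x\<close>, so each of the two Taylor remainders of \<open>f'\<close> is at most \<open>\<eta> t C\<close>.\<close>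
    define E where "E = (f' y1 - f' x - f'' (y1 - x)) - (f' y2 - f' x - f'' (y2 - x))"
    have "norm E \<le> \<eta> * norm (y1 - x) + \<eta> * norm (y2 - x)"
      unfolding E_def using n1 n2 tC
      by (intro order_trans[OF norm_triangle_ineq4] add_mono d1) (auto simp: d_def)
    also have "\<dots> \<le> \<eta> * (t * C) + \<eta> * (t * C)"
      using n1 n2 \<eta> by (intro add_mono mult_left_mono) auto
    finally have nE: "norm E \<le> 2 * \<eta> * t * C" by (simp add: mult_ac)
    have "y1 - x = (y2 - x) + t *\<^sub>R k" by (simp add: y1_def y2_def)
    then have "f'' (y1 - x) = f'' (y2 - x) + t *\<^sub>R f'' k"
      by (simp only: blinfun.add_right blinfun.scaleR_right)
    then have Eeq: "E = f' y1 - f' y2 - t *\<^sub>R f'' k"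
      unfolding E_def by (simp add: algebra_simps)
    have \<phi>s: "\<phi>' s = f' y1 (t *\<^sub>R h) - f' y2 (t *\<^sub>R h)"
      unfolding \<phi>'_def y1_def y2_def ..
    have "E (t *\<^sub>R h) = \<phi>' s - t\<^sup>2 * f'' k h"
      unfolding Eeq \<phi>s
      by (simp add: blinfun.diff_left blinfun.add_left blinfun.scaleR_left blinfun.scaleR_right power2_eq_square algebra_simps)
    moreover have "\<bar>E (t *\<^sub>R h)\<bar> \<le> norm E * (t * norm h)"
      using norm_blinfun[of E "t *\<^sub>R h"] t by simp
    moreover have "norm E * (t * norm h) \<le> (2 * \<eta> * t * C) * (t * norm h)"
      using nE t by (intro mult_right_mono) auto
    ultimately have b: "\<bar>\<phi>' s - t\<^sup>2 * f'' k h\<bar> \<le> t\<^sup>2 * (2 * \<eta> * C * norm h)"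
      by (simp add: power2_eq_square mult_ac)
    have "f (x + t *\<^sub>R h + t *\<^sub>R k) - f (x + t *\<^sub>R h) - f (x + t *\<^sub>R k) + f x = \<phi>' s"
      using s(3) by (simp add: \<phi>_def)
    then have "\<bar>(f (x + t *\<^sub>R h + t *\<^sub>R k) - f (x + t *\<^sub>R h) - f (x + t *\<^sub>R k) + f x) / t\<^sup>2 - f'' k h\<bar>
       = \<bar>\<phi>' s / t\<^sup>2 - f'' k h\<bar>"
      by simp
    also have "\<phi>' s / t\<^sup>2 - f'' k h = (\<phi>' s - t\<^sup>2 * f'' k h) / t\<^sup>2"
      using t by (simp add: field_simps)
    also have "\<bar>\<dots>\<bar> = \<bar>\<phi>' s - t\<^sup>2 * f'' k h\<bar> / t\<^sup>2"
      by (simp add: abs_divide)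
    also have "\<dots> \<le> 2 * \<eta> * C * norm h"
      using b t by (simp add: field_simps)
    also have "\<dots> = e * (norm h / C)"
      using C by (simp add: \<eta>_def field_simps)
    also have "\<dots> < e * 1"
      using C e by (intro mult_strict_left_mono) auto
    finally show ?thesis by (simp add: dist_real_def)
  qed
  then show "\<forall>\<^sub>F t in at_right 0.
     dist ((f (x + t *\<^sub>R h + t *\<^sub>R k) - f (x + t *\<^sub>R h) - f (x + t *\<^sub>R k) + f x) / t\<^sup>2) (f'' k h) < e"
    using d C by (subst eventually_at_right[of 0 1]) (auto intro!: exI[of _ "d / C"])
qed

text \<open>The second difference is symmetric in \<open>h\<close> and \<open>k\<close>, hence so is its limit.\<close>

lemma symmetric_second_derivative:
  fixes f :: "'a::real_normed_vector \<Rightarrow> real" and f'' :: "'a \<Rightarrow>\<^sub>L 'a \<Rightarrow>\<^sub>L real"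
  assumes "open S" "x \<in> S"
    and "\<And>y. y \<in> S \<Longrightarrow> (f has_derivative blinfun_apply (f' y)) (at y)"
    and "(f' has_derivative blinfun_apply f'') (at x)"
  shows "f'' h k = f'' k h"
proof -
  have "((\<lambda>t. (f (x + t *\<^sub>R h + t *\<^sub>R k) - f (x + t *\<^sub>R h) - f (x + t *\<^sub>R k) + f x) / t\<^sup>2)
           \<longlongrightarrow> f'' h k) (at_right 0)"
    using second_difference_tendsto[OF assms, of k h] by (simp add: algebra_simps)
  then show ?thesis
    using second_difference_tendsto[OF assms, of h k] tendsto_unique[OF trivial_limit_at_right_real] by blast
qed

section \<open>Harmonic functions on a disc as real parts\<close>

lemma harmonic_on_bounded_linear_compose:
  fixes f :: "'a::euclidean_space \<Rightarrow> 'b::real_normed_vector" and T :: "'b \<Rightarrow> 'c::real_normed_vector"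
  assumes T: "bounded_linear T" and f: "harmonic_on S f"
  shows "harmonic_on S (\<lambda>x. T (f x))"
proof -
  obtain f' f'' where f': "second_derivs_on S f f' f''"
    and tr: "\<And>x. x \<in> S \<Longrightarrow> (\<Sum>b\<in>Basis. f'' x b b) = 0"
    using f unfolding harmonic_on_def by blast
  interpret T: bounded_linear T by fact
  have TB [simp]: "blinfun_apply (Blinfun T) = T" by (rule bounded_linear_Blinfun_apply[OF T])
  define P where "P A = Blinfun T o\<^sub>L A" for A :: "'a \<Rightarrow>\<^sub>L 'b"
  have P: "bounded_linear P"
    unfolding P_def by (rule bounded_bilinear.bounded_linear_right[OF bounded_bilinear_blinfun_compose])
  have PB [simp]: "blinfun_apply (Blinfun P) = P" by (rule bounded_linear_Blinfun_apply[OF P])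
  have "second_derivs_on S (\<lambda>x. T (f x)) (\<lambda>x. P (f' x)) (\<lambda>x. Blinfun P o\<^sub>L f'' x)"
    unfolding second_derivs_on_def
  proof (intro conjI ballI)
    show "open S" using f' by (simp add: second_derivs_on_def)
    fix x assume x: "x \<in> S"
    show "((\<lambda>x. T (f x)) has_derivative blinfun_apply (P (f' x))) (at x)"
      using bounded_linear.has_derivative[OF T, of f "blinfun_apply (f' x)" "at x"] f' x
      by (simp add: second_derivs_on_def P_def o_def blinfun_compose.rep_eq)
    show "((\<lambda>x. P (f' x)) has_derivative blinfun_apply (Blinfun P o\<^sub>L f'' x)) (at x)"
      using bounded_linear.has_derivative[OF P, of f' "blinfun_apply (f'' x)" "at x"] f' x
      by (simp add: second_derivs_on_def o_def blinfun_compose.rep_eq)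
  next
    show "continuous_on S (\<lambda>x. Blinfun P o\<^sub>L f'' x)"
      using f' unfolding second_derivs_on_def by (intro continuous_intros) auto
  qed
  moreover have "(\<Sum>b\<in>Basis. (Blinfun P o\<^sub>L f'' x) b b) = 0" if "x \<in> S" for x
    using tr[OF that] by (simp add: P_def flip: T.sum)
  ultimately show ?thesis unfolding harmonic_on_def by blast
qed

lemma harmonic_on_translate:
  assumes "harmonic_on (ball 0 r) (\<lambda>x. f (a + x))"
  shows "harmonic_on (ball a r) f"
proof -
  obtain f' f'' where f': "second_derivs_on (ball 0 r) (\<lambda>x. f (a + x)) f' f''"
    and tr: "\<And>x. x \<in> ball 0 r \<Longrightarrow> (\<Sum>b\<in>Basis. f'' x b b) = 0"
    using assms unfolding harmonic_on_def by blast
  have sub: "x - a \<in> ball 0 r" if "x \<in> ball a r" for x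
    using that by (simp add: dist_norm norm_minus_commute)
  have shift: "((\<lambda>x. x - a) has_derivative (\<lambda>h. h)) (at x)" for x
    by (auto intro!: derivative_eq_intros)
  have "second_derivs_on (ball a r) f (\<lambda>x. f' (x - a)) (\<lambda>x. f'' (x - a))"
    unfolding second_derivs_on_def
  proof (intro conjI ballI)
    fix x assume x: "x \<in> ball a r"
    show "(f has_derivative blinfun_apply (f' (x - a))) (at x)"
      using has_derivative_compose[OF shift, of "\<lambda>x. f (a + x)" _ x] f' sub[OF x]
      by (simp add: second_derivs_on_def)
    show "((\<lambda>x. f' (x - a)) has_derivative blinfun_apply (f'' (x - a))) (at x)"
      using has_derivative_compose[OF shift, of f' _ x] f' sub[OF x]
      by (simp add: second_derivs_on_def)
  next
    show "continuous_on (ball a r) (\<lambda>x. f'' (x - a))"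
      using f' sub unfolding second_derivs_on_def
      by (intro continuous_on_compose2[of "ball 0 r" f'' _ "\<lambda>x. x - a"] continuous_intros) auto
  qed auto
  then show ?thesis using tr sub unfolding harmonic_on_def by blast
qed

text \<open>This is twice the Wirtinger derivative \<open>\<partial>\<phi>/\<partial>\<zeta>\<close>.  If \<open>\<phi> = Re F\<close> with \<open>F\<close> holomorphic, it
is \<open>F'\<close>.\<close>

definition complex_gradient :: "(complex \<Rightarrow> real) \<Rightarrow> complex \<Rightarrow> complex" where
  "complex_gradient \<phi> \<zeta> =
     Complex (frechet_derivative \<phi> (at \<zeta>) 1) (- frechet_derivative \<phi> (at \<zeta>) \<i>)"

lemma linear_complex_expand:
  assumes "linear (A :: complex \<Rightarrow> 'b::real_vector)"
  shows "A h = Re h *\<^sub>R A 1 + Im h *\<^sub>R A \<i>"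
proof -
  have "h = Re h *\<^sub>R 1 + Im h *\<^sub>R \<i>" by (simp add: complex_eq_iff)
  then show ?thesis using assms by (metis linear_add linear_scale)
qed

lemma Re_complex_gradient_mult:
  assumes "(\<phi> has_derivative A) (at \<zeta>)"
  shows "Re (complex_gradient \<phi> \<zeta> * h) = A h"
  using linear_complex_expand[OF has_derivative_linear[OF assms], of h]
  by (simp add: complex_gradient_def frechet_derivative_at[OF assms, symmetric] mult.commute)

text \<open>The Cauchy--Riemann equations for the complex gradient \<open>\<phi>\<^sub>x - \<i> \<phi>\<^sub>y\<close> are exactly the vanishing of
the Laplacian and the symmetry of the mixed derivatives.\<close>

lemma complex_gradient_field_differentiable:
  assumes h: "harmonic_on S \<phi>" and x: "x \<in> S"
  shows "complex_gradient \<phi> field_differentiable (at x)"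
proof -
  obtain f' f'' where f': "second_derivs_on S \<phi> f' f''"
    and tr: "\<And>x. x \<in> S \<Longrightarrow> (\<Sum>b\<in>Basis. f'' x b b) = 0"
    using h unfolding harmonic_on_def by blast
  have S: "open S" and d1: "\<And>y. y \<in> S \<Longrightarrow> (\<phi> has_derivative f' y) (at y)"
    and d2: "(f' has_derivative f'' x) (at x)"
    using f' x unfolding second_derivs_on_def by auto
  have sym: "f'' x \<i> 1 = f'' x 1 \<i>"
    by (rule symmetric_second_derivative[OF S x d1 d2])
  have lap: "f'' x 1 1 + f'' x \<i> \<i> = 0"
    using tr[OF x] by (simp add: Basis_complex_def)
  define c where "c = Complex (f'' x 1 1) (- f'' x 1 \<i>)"
  have g: "complex_gradient \<phi> y = of_real (f' y 1) - \<i> * of_real (f' y \<i>)" if "y \<in> S" for y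
    using frechet_derivative_at[OF d1[OF that], symmetric]
    by (simp add: complex_gradient_def complex_eq_iff)
  have lin: "linear (\<lambda>h. f'' x h k)" for k
    by (intro bounded_linear.linear bounded_linear_intros)
  have "((\<lambda>y. complex_of_real (f' y 1) - \<i> * of_real (f' y \<i>)) has_derivative
          (\<lambda>h. of_real (f'' x h 1) - \<i> * of_real (f'' x h \<i>))) (at x)"
    by (auto intro!: derivative_eq_intros d2)
  also have "(\<lambda>h. of_real (f'' x h 1) - \<i> * of_real (f'' x h \<i>)) = (*) c"
  proof
    fix h
    show "of_real (f'' x h 1) - \<i> * of_real (f'' x h \<i>) = c * h"
      using sym lap linear_complex_expand[OF lin, of h 1] linear_complex_expand[OF lin, of h \<i>]
      by (simp add: c_def complex_eq_iff algebra_simps)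
        (metis add_eq_0_iff mult_minus_right)
  qed
  finally have "((\<lambda>y. complex_of_real (f' y 1) - \<i> * of_real (f' y \<i>)) has_field_derivative c) (at x)"
    by (simp add: has_field_derivative_def)
  then have "(complex_gradient \<phi> has_field_derivative c) (at x)"
    by (rule has_field_derivative_transform_within_open[OF _ S x]) (simp add: g)
  then show ?thesis unfolding field_differentiable_def by blast
qed

text \<open>The complex gradient is holomorphic, so it has a primitive on a convex set, and the real part of
that primitive has the same derivative as \<open>\<phi>\<close>.  Harmonicity is assumed only near each
point: pluriharmonicity speaks of discs centred at the point under consideration, and these do not
fill a slice of the ball.\<close>

lemma harmonic_real_part_of_holomorphic:
  assumes S: "open S" "convex S"
    and loc: "\<And>\<zeta>. \<zeta> \<in> S \<Longrightarrow> \<exists>r>0. harmonic_on (ball \<zeta> r) \<phi>"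
  obtains F where "F holomorphic_on S" "\<And>\<zeta>. \<zeta> \<in> S \<Longrightarrow> Re (F \<zeta>) = \<phi> \<zeta>"
proof (cases "S = {}")
  case False
  then obtain a where a: "a \<in> S" by blast
  have "complex_gradient \<phi> holomorphic_on S"
    unfolding holomorphic_on_open[OF S(1)] field_differentiable_def[symmetric]
    using loc complex_gradient_field_differentiable centre_in_ball by blast
  then obtain G where G: "\<And>\<zeta>. \<zeta> \<in> S \<Longrightarrow> (G has_field_derivative complex_gradient \<phi> \<zeta>) (at \<zeta> within S)"
    using holomorphic_convex_primitive'[OF S(2,1)] by blast
  have "((\<lambda>\<zeta>. Re (G \<zeta>) - \<phi> \<zeta>) has_derivative (\<lambda>h. 0)) (at \<zeta> within S)" if \<zeta>: "\<zeta> \<in> S" for \<zeta>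
  proof -
    obtain r f' where "r > 0" and "\<forall>y\<in>ball \<zeta> r. (\<phi> has_derivative blinfun_apply (f' y)) (at y)"
      using loc[OF \<zeta>] unfolding harmonic_on_def second_derivs_on_def by blast
    then have f': "(\<phi> has_derivative blinfun_apply (f' \<zeta>)) (at \<zeta>)" by simp
    have "((\<lambda>\<zeta>. Re (G \<zeta>)) has_derivative (\<lambda>h. Re (complex_gradient \<phi> \<zeta> * h))) (at \<zeta> within S)"
      using G[OF \<zeta>] unfolding has_field_derivative_def by (intro derivative_intros)
    then have "((\<lambda>\<zeta>. Re (G \<zeta>)) has_derivative f' \<zeta>) (at \<zeta> within S)"
      by (simp only: Re_complex_gradient_mult[OF f'])
    from has_derivative_diff[OF this has_derivative_at_withinI[OF f']]
    show ?thesis by simp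
  qed
  then obtain c where c: "\<And>\<zeta>. \<zeta> \<in> S \<Longrightarrow> Re (G \<zeta>) - \<phi> \<zeta> = c"
    using has_derivative_zero_constant[OF S(2), of "\<lambda>\<zeta>. Re (G \<zeta>) - \<phi> \<zeta>"] by auto
  show ?thesis
  proof
    have "G holomorphic_on S" using G by (auto simp: holomorphic_on_def field_differentiable_def)
    then show "(\<lambda>\<zeta>. G \<zeta> - of_real c) holomorphic_on S" by (intro holomorphic_intros)
  qed (use c in force)
next
  case True
  show ?thesis by (rule that[of "\<lambda>_. 0"]) (simp_all add: True)
qed

section \<open>The Schwarz--Pick estimate for maps into a strip\<close>

text \<open>In the half plane the point \<open>w\<close> is closer to \<open>w0\<close> than to the mirror image \<open>- cnj w0\<close>.\<close>

lemma right_half_plane_Cayley_norm_less: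
  assumes "Re w > 0" "Re w0 > 0"
  shows "w + cnj w0 \<noteq> 0" "cmod ((w - w0) / (w + cnj w0)) < 1"
proof -
  have "Re (w + cnj w0) > 0" using assms by simp
  then show nz: "w + cnj w0 \<noteq> 0" by (metis less_irrefl zero_complex.simps(1))
  have "(cmod (w + cnj w0))\<^sup>2 - (cmod (w - w0))\<^sup>2 = 4 * Re w * Re w0"
    unfolding cmod_power2 by (simp add: power2_eq_square algebra_simps)
  moreover have "4 * Re w * Re w0 > 0" using assms by simp
  ultimately have "(cmod (w - w0))\<^sup>2 < (cmod (w + cnj w0))\<^sup>2" by linarith
  then have "cmod (w - w0) < cmod (w + cnj w0)" by (rule power_less_imp_less_base) simp
  then show "cmod ((w - w0) / (w + cnj w0)) < 1" using nz by (simp add: norm_divide)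
qed

lemma Re_exp_strip: "Re (exp (\<i> * of_real (pi / 2) * f)) =
    cmod (exp (\<i> * of_real (pi / 2) * f)) * cos (pi / 2 * Re f)"
  by (simp add: Re_exp)

lemma cos_strip_pos:
  assumes "\<bar>t\<bar> < 1" shows "cos (pi / 2 * t) > 0"
proof (rule cos_gt_zero_pi)
  have "pi / 2 * - 1 < pi / 2 * t" "pi / 2 * t < pi / 2 * 1"
    using assms by (intro mult_strict_left_mono; simp add: abs_less_iff)+
  then show "- (pi / 2) < pi / 2 * t" "pi / 2 * t < pi / 2" by simp_all
qed

text \<open>The Schwarz lemma is applied to \<open>h\<close>, the composition of the Moebius map \<open>\<phi>\<close> of the unit disc
onto \<open>ball c r\<close> with \<open>\<phi> 0 = a\<close>, the function \<open>F\<close>, the map \<open>exp (\<i> \<pi> f / 2)\<close> of the strip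
onto the right half plane, and the Cayley transform that sends the image \<open>w0\<close> of \<open>a\<close> to \<open>0\<close>.\<close>

lemma strip_Schwarz_Pick:
  fixes F :: "complex \<Rightarrow> complex"
  assumes hol: "F holomorphic_on ball c r"
    and strip: "\<And>\<zeta>. \<zeta> \<in> ball c r \<Longrightarrow> \<bar>Re (F \<zeta>)\<bar> < 1"
    and a: "a \<in> ball c r"
  shows "cmod (deriv F a) \<le> 4 / pi * cos (pi / 2 * Re (F a)) * (r / (r\<^sup>2 - (cmod (a - c))\<^sup>2))"
proof -
  have r: "r > 0" using a by (metis ball_eq_empty empty_iff not_le)
  define b where "b = (a - c) / of_real r"
  have b: "cmod b < 1" using a r by (simp add: b_def norm_divide dist_norm norm_minus_commute)
  define \<phi> where "\<phi> \<zeta> = c + of_real r * Moebius_function 0 (- b) \<zeta>" for \<zeta>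
  \<comment> \<open>The derivative of \<open>\<phi>\<close> at \<open>0\<close>, equal to \<open>(r\<^sup>2 - \<bar>a - c\<bar>\<^sup>2) / r\<close>.\<close>
  define s where "s = r * (1 - (cmod b)\<^sup>2)"
  have s: "s > 0" using r b by (simp add: s_def power_less_one_iff)
  have \<phi>0: "\<phi> 0 = a" using r by (simp add: \<phi>_def Moebius_function_simple b_def)
  have \<phi>_in: "\<phi> \<zeta> \<in> ball c r" if "\<zeta> \<in> ball 0 1" for \<zeta>
  proof -
    have "cmod (Moebius_function 0 (- b) \<zeta>) < 1" using that b by (intro Moebius_function_norm_lt_1) auto
    then show ?thesis using r by (simp add: \<phi>_def dist_norm norm_mult)
  qed
  have \<phi>_hol: "\<phi> holomorphic_on ball 0 1"
    unfolding \<phi>_def using b by (intro holomorphic_intros Moebius_function_holomorphic) auto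
  have \<phi>': "(\<phi> has_field_derivative of_real s) (at 0)"
  proof -
    have "of_real s = of_real r * (1 - b * cnj b)"
      by (simp add: s_def flip: complex_norm_square)
    then show ?thesis
      unfolding \<phi>_def Moebius_function_simple
      by (auto intro!: derivative_eq_intros simp: algebra_simps)
  qed
  define W where "W \<zeta> = exp (\<i> * of_real (pi / 2) * F (\<phi> \<zeta>))" for \<zeta>
  have W_hol: "W holomorphic_on ball 0 1"
  proof -
    have "(F \<circ> \<phi>) holomorphic_on ball 0 1"
      using \<phi>_in by (intro holomorphic_on_compose_gen[OF \<phi>_hol hol]) auto
    then show ?thesis unfolding W_def o_def by (intro holomorphic_intros)
  qed
  have W_pos: "Re (W \<zeta>) > 0" if "\<zeta> \<in> ball 0 1" for \<zeta>
    unfolding W_def Re_exp_strip using cos_strip_pos[OF strip[OF \<phi>_in[OF that]]] by simp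
  define w0 where "w0 = W 0"
  have w0: "Re w0 > 0" unfolding w0_def by (rule W_pos) simp
  define h where "h \<zeta> = (W \<zeta> - w0) / (W \<zeta> + cnj w0)" for \<zeta>
  have "h holomorphic_on ball 0 1"
    unfolding h_def using right_half_plane_Cayley_norm_less(1)[OF W_pos w0]
    by (intro holomorphic_intros W_hol) auto
  moreover have "h 0 = 0" by (simp add: h_def w0_def)
  moreover have "cmod (h \<zeta>) < 1" if "cmod \<zeta> < 1" for \<zeta>
    unfolding h_def using that by (intro right_half_plane_Cayley_norm_less W_pos w0) auto
  ultimately have Schwarz: "cmod (deriv h 0) \<le> 1"
    using Schwarz_Lemma(2)[of h 0] by simp
  have F': "(F has_field_derivative deriv F a) (at a)"
    using holomorphic_derivI[OF hol open_ball a] .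
  have "(F has_field_derivative deriv F a) (at (\<phi> 0))" using F' \<phi>0 by simp
  then have "((\<lambda>\<zeta>. F (\<phi> \<zeta>)) has_field_derivative deriv F a * of_real s) (at 0)"
    by (rule DERIV_chain2[OF _ \<phi>'])
  then have W': "(W has_field_derivative w0 * (\<i> * of_real (pi / 2) * (deriv F a * of_real s))) (at 0)"
    unfolding W_def w0_def by (auto intro!: derivative_eq_intros)
  have nz: "w0 + cnj w0 \<noteq> 0" by (rule right_half_plane_Cayley_norm_less(1)[OF w0 w0])
  have "(h has_field_derivative w0 * (\<i> * of_real (pi / 2) * (deriv F a * of_real s)) / (w0 + cnj w0)) (at 0)"
    unfolding h_def using nz
    by (auto intro!: derivative_eq_intros W' simp flip: w0_def)
  then have dh: "deriv h 0 = w0 * (\<i> * of_real (pi / 2) * (deriv F a * of_real s)) / (w0 + cnj w0)"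
    by (rule DERIV_imp_deriv)
  have dn: "cmod (w0 + cnj w0) = 2 * Re w0"
    using w0 by (simp add: complex_add_cnj)
  have "cmod w0 * (pi / 2 * (cmod (deriv F a) * s)) / (2 * Re w0) \<le> 1"
    using Schwarz s unfolding dh norm_divide norm_mult dn by simp
  then have "cmod w0 * (pi / 2 * (cmod (deriv F a) * s)) \<le> 2 * Re w0"
    using w0 by (simp add: divide_le_eq)
  \<comment> \<open>The argument of \<open>w0\<close> is \<open>\<pi> / 2\<close> times the real part of \<open>F a\<close>, which brings in the cosine.\<close>
  also have "Re w0 = cmod w0 * cos (pi / 2 * Re (F a))"
    unfolding w0_def W_def Re_exp_strip \<phi>0 ..
  finally have "cmod w0 * (pi / 2 * (cmod (deriv F a) * s)) \<le> cmod w0 * (2 * cos (pi / 2 * Re (F a)))"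
    by (simp add: mult_ac)
  then have "pi / 2 * (cmod (deriv F a) * s) \<le> 2 * cos (pi / 2 * Re (F a))"
    using w0 by (subst (asm) mult_le_cancel_left_pos) auto
  then have "cmod (deriv F a) \<le> 4 / pi * cos (pi / 2 * Re (F a)) * (1 / s)"
    using s by (simp add: field_simps)
  also have "s = (r\<^sup>2 - (cmod (a - c))\<^sup>2) / r"
    using r by (simp add: s_def b_def norm_divide power_divide field_simps power2_eq_square)
  finally show ?thesis by simp
qed

text \<open>By \<open>cos (2 x) = 1 - 2 (sin x)\<^sup>2\<close> the claim is \<open>sin (\<bar>t\<bar> \<pi> / 4) \<ge> \<bar>t\<bar> sin (\<pi> / 4)\<close>, which is
concavity of the sine.\<close>

lemma cos_half_pi_le:
  assumes "\<bar>t\<bar> \<le> 1"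
  shows "cos (pi / 2 * t) \<le> 1 - t\<^sup>2"
proof -
  have conv: "convex_on {0..pi/4} (\<lambda>x. - sin x)"
  proof (rule f''_ge0_imp_convex)
    show "\<And>x. DERIV (\<lambda>x. - sin x) x :> - cos x" "\<And>x. DERIV (\<lambda>x. - cos x) x :> sin x"
      by (auto intro!: derivative_eq_intros)
    show "\<And>x. x \<in> {0..pi/4} \<Longrightarrow> 0 \<le> sin x"
      by (rule sin_ge_zero) auto
  qed auto
  have "- sin ((1 - \<bar>t\<bar>) *\<^sub>R 0 + \<bar>t\<bar> *\<^sub>R (pi/4)) \<le> (1 - \<bar>t\<bar>) * - sin 0 + \<bar>t\<bar> * - sin (pi/4)"
    using convex_onD[OF conv, of "\<bar>t\<bar>" 0 "pi/4"] assms by simp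
  then have "\<bar>t\<bar> * (sqrt 2 / 2) \<le> sin (\<bar>t\<bar> * (pi/4))"
    by (simp add: sin_45)
  then have "(\<bar>t\<bar> * (sqrt 2 / 2))\<^sup>2 \<le> (sin (\<bar>t\<bar> * (pi/4)))\<^sup>2"
    by (intro power_mono) auto
  then have "t\<^sup>2 \<le> 2 * (sin (\<bar>t\<bar> * (pi/4)))\<^sup>2"
    by (simp add: power_mult_distrib power_divide)
  moreover have "cos (pi / 2 * t) = cos (2 * (\<bar>t\<bar> * (pi/4)))"
    by (cases "t \<ge> 0") (simp_all add: mult.commute)
  ultimately show ?thesis
    by (simp only: cos_double_sin)
qed

section \<open>Duality for the \<open>\<ell>\<^sub>p\<close> norm\<close>

lemma lp_norm_nonneg: "lp_norm p x \<ge> 0"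
  by (simp add: lp_norm_def)

lemma lp_norm_powr:
  assumes "p > 0"
  shows "lp_norm p x powr p = (\<Sum>j\<in>UNIV. norm (x $ j) powr p)"
  using assms by (simp add: lp_norm_def powr_powr sum_nonneg)

lemma lp_norm_eq_0_iff:
  assumes "p > 0"
  shows "lp_norm p x = 0 \<longleftrightarrow> x = 0"
  using assms by (simp add: lp_norm_def sum_nonneg_eq_0_iff vec_eq_iff)

lemma lp_norm_uminus: "lp_norm p (- x) = lp_norm p x"
  by (simp add: lp_norm_def)

lemma lp_norm_axis:
  fixes t :: real
  assumes "p > 0" shows "lp_norm p (axis j t) = \<bar>t\<bar>"
proof -
  have "(\<Sum>i\<in>UNIV. norm (axis j t $ i) powr p) = (\<Sum>i\<in>UNIV. if i = j then \<bar>t\<bar> powr p else 0)"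
    by (intro sum.cong) (auto simp: axis_def)
  then show ?thesis using assms by (simp add: lp_norm_def powr_powr)
qed

lemma lp_norm_le_norm:
  fixes x :: "real ^ 'm"
  assumes "p > 0"
  shows "lp_norm p x \<le> of_nat CARD('m) powr (1 / p) * norm x"
proof -
  have "(\<Sum>j\<in>UNIV. norm (x $ j) powr p) \<le> (\<Sum>j\<in>(UNIV::'m set). norm x powr p)"
    using assms by (intro sum_mono powr_mono2) (auto simp: component_le_norm_cart)
  then have "lp_norm p x \<le> (of_nat CARD('m) * norm x powr p) powr (1 / p)"
    unfolding lp_norm_def using assms by (intro powr_mono2) (auto intro: sum_nonneg)
  then show ?thesis using assms by (simp add: powr_mult powr_powr)
qed

text \<open>The gradient of the \<open>\<ell>\<^sub>p\<close> norm at a nonzero \<open>x\<close>.  It has norm one in the dual space; at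
\<open>x = 0\<close> the formula gives the zero functional.\<close>

definition norming_functional :: "real \<Rightarrow> real ^ 'm \<Rightarrow> real ^ 'm" where
  "norming_functional p x = (\<chi> j. sgn (x $ j) * (\<bar>x $ j\<bar> / lp_norm p x) powr (p - 1))"

lemma lp_norm_normalized:
  fixes x :: "real ^ 'm"
  assumes p: "p > 0" and x: "x \<noteq> 0"
  shows "(\<Sum>j\<in>UNIV. (\<bar>x $ j\<bar> / lp_norm p x) powr p) = 1"
proof -
  have N: "lp_norm p x > 0" using lp_norm_eq_0_iff[OF p] x lp_norm_nonneg[of p x] by (metis less_eq_real_def)
  have "(\<Sum>j\<in>UNIV. (\<bar>x $ j\<bar> / lp_norm p x) powr p) = (\<Sum>j\<in>UNIV. norm (x $ j) powr p) / lp_norm p x powr p"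
    using N by (simp add: powr_divide sum_divide_distrib)
  also have "\<dots> = 1" unfolding lp_norm_powr[OF p, symmetric] using N by simp
  finally show ?thesis .
qed

lemma norming_functional_attains:
  fixes x :: "real ^ 'm"
  assumes p: "p > 1"
  shows "norming_functional p x \<bullet> x = lp_norm p x"
proof (cases "x = 0")
  case False
  define N where "N = lp_norm p x"
  have N: "N > 0" using lp_norm_eq_0_iff[of p x] False p lp_norm_nonneg[of p x] by (simp add: N_def less_eq_real_def)
  have "norming_functional p x \<bullet> x = (\<Sum>j\<in>UNIV. N * (\<bar>x $ j\<bar> / N) powr p)"
    unfolding inner_vec_def
  proof (rule sum.cong[OF refl])
    fix j
    have "(\<bar>x $ j\<bar> / N) powr p = (\<bar>x $ j\<bar> / N) powr (p - 1) * (\<bar>x $ j\<bar> / N)"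
      using N powr_mult_base[of "\<bar>x $ j\<bar> / N" "p - 1"] by (simp add: mult.commute)
    then show "norming_functional p x $ j \<bullet> x $ j = N * (\<bar>x $ j\<bar> / N) powr p"
      using N by (simp add: norming_functional_def flip: N_def) (simp add: sgn_if mult_ac)
  qed
  also have "\<dots> = N"
    using lp_norm_normalized[of p x] p False by (simp add: N_def flip: sum_distrib_left)
  finally show ?thesis by (simp add: N_def)
qed (use p in \<open>simp add: lp_norm_eq_0_iff\<close>)

text \<open>Hoelder's inequality for this particular functional, by Young's inequality applied to the
normalised coordinates of \<open>x\<close> and \<open>y\<close>.\<close>

lemma norming_functional_le:
  fixes x y :: "real ^ 'm"
  assumes p: "p > 1"
  shows "norming_functional p x \<bullet> y \<le> lp_norm p y"
proof (cases "x = 0 \<or> y = 0")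
  case True
  then show ?thesis
    using lp_norm_nonneg[of p y] by (auto simp: norming_functional_def inner_vec_def)
next
  case False
  define a where "a j = \<bar>x $ j\<bar> / lp_norm p x" for j
  define b where "b j = \<bar>y $ j\<bar> / lp_norm p y" for j
  have M: "lp_norm p y > 0"
    using lp_norm_eq_0_iff[of p y] False p lp_norm_nonneg[of p y] by (simp add: less_eq_real_def)
  have ab: "a j \<ge> 0" "b j \<ge> 0" for j
    by (simp_all add: a_def b_def lp_norm_nonneg)
  have Young: "a j powr (p - 1) * b j \<le> a j powr p * (1 - 1 / p) + b j powr p * (1 / p)" for j
  proof -
    have "a j powr (p - 1) * b j \<le> (a j powr (p - 1)) powr (p / (p - 1)) / (p / (p - 1)) + b j powr p / p"
      using p ab by (intro Youngs_inequality) (auto simp: field_simps)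
    also have "(a j powr (p - 1)) powr (p / (p - 1)) = a j powr p"
      using p by (simp add: powr_powr)
    finally show ?thesis using p by (simp add: field_simps)
  qed
  have "norming_functional p x \<bullet> y \<le> (\<Sum>j\<in>UNIV. lp_norm p y * (a j powr (p - 1) * b j))"
    unfolding inner_vec_def
  proof (rule sum_mono)
    fix j
    have "norming_functional p x $ j \<bullet> y $ j \<le> \<bar>norming_functional p x $ j\<bar> * \<bar>y $ j\<bar>"
      by (simp add: abs_mult[symmetric])
    also have "\<dots> \<le> a j powr (p - 1) * \<bar>y $ j\<bar>"
      by (intro mult_right_mono) (auto simp: norming_functional_def a_def abs_mult sgn_if)
    also have "\<dots> = lp_norm p y * (a j powr (p - 1) * b j)"
      using M by (simp add: b_def)
    finally show "norming_functional p x $ j \<bullet> y $ j \<le> lp_norm p y * (a j powr (p - 1) * b j)" .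
  qed
  also have "\<dots> \<le> (\<Sum>j\<in>UNIV. lp_norm p y * (a j powr p * (1 - 1 / p) + b j powr p * (1 / p)))"
    using M Young by (intro sum_mono mult_left_mono) auto
  also have "\<dots> = lp_norm p y * ((\<Sum>j\<in>UNIV. a j powr p) * (1 - 1 / p) + (\<Sum>j\<in>UNIV. b j powr p) * (1 / p))"
    by (simp only: sum.distrib flip: sum_distrib_left sum_distrib_right)
  also have "\<dots> = lp_norm p y"
    using lp_norm_normalized[of p x] lp_norm_normalized[of p y] p False by (simp add: a_def b_def)
  finally show ?thesis .
qed

lemma abs_norming_functional_le:
  fixes x y :: "real ^ 'm"
  assumes p: "p > 1"
  shows "\<bar>norming_functional p x \<bullet> y\<bar> \<le> lp_norm p y"
  using norming_functional_le[OF p, of x y] norming_functional_le[OF p, of x "- y"]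
  by (simp add: lp_norm_uminus abs_le_iff)

text \<open>A norming functional at the larger point dominates the increment of the norm; this replaces the
triangle inequality and the differentiability of the norm.\<close>

lemma lp_norm_diff_le:
  fixes x y :: "real ^ 'm"
  assumes p: "p > 1"
  shows "lp_norm p x - lp_norm p y \<le> norming_functional p x \<bullet> (x - y)"
  using norming_functional_attains[OF p, of x] norming_functional_le[OF p, of x y]
  by (simp add: inner_diff_right)

text \<open>If \<open>\<parallel>u w\<parallel>\<^sub>p \<ge> \<parallel>u z\<parallel>\<^sub>p\<close>, the increment of the norm is tested with the functional that norms \<open>u w\<close>.
Its value at \<open>u z\<close> is only close to \<open>\<parallel>u z\<parallel>\<^sub>p\<close>, and this costs the term
\<open>4 a C \<parallel>u w - u z\<parallel>\<close> in \<open>G\<close>, which tends to \<open>0\<close>.  In the opposite case the functional that norms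
\<open>u z\<close> gives the bound without this error.\<close>

lemma grad_lp_norm_le:
  fixes u :: "'a::{real_normed_vector,perfect_space} \<Rightarrow> real ^ 'm"
  assumes p: "p > 1" and A: "(u has_derivative A) (at z)" and K: "K \<ge> 0"
    and bound: "\<And>x h. \<bar>norming_functional p x \<bullet> A h\<bar>
                   \<le> K * (1 - (norming_functional p x \<bullet> u z)\<^sup>2) * norm h"
  shows "grad_lp_norm p u z \<le> ereal (K * (1 - (lp_norm p (u z))\<^sup>2))"
proof -
  define C where "C = of_nat CARD('m) powr (1 / p)"
  define a where "a = lp_norm p (u z)"
  have a: "a \<ge> 0" by (simp add: a_def lp_norm_nonneg)
  have C: "lp_norm p y \<le> C * norm y" for y :: "real ^ 'm"
    unfolding C_def using p by (intro lp_norm_le_norm) auto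
  have lC: "\<bar>norming_functional p x \<bullet> y\<bar> \<le> C * norm y" for x y :: "real ^ 'm"
    using abs_norming_functional_le[OF p, of x y] C[of y] by linarith
  have NC: "lp_norm p x - lp_norm p y \<le> C * norm (x - y)" for x y :: "real ^ 'm"
    using lp_norm_diff_le[OF p, of x y] lC[of x "x - y"] by linarith
  define R where "R w = u w - u z - A (w - z)" for w
  define G where "G w = K * (1 - a\<^sup>2 + 4 * a * C * norm (u w - u z)) + C * (norm (R w) / norm (w - z))" for w
  have "\<bar>lp_norm p (u z) - lp_norm p (u w)\<bar> / norm (z - w) \<le> G w" if w: "w \<noteq> z" for w
  proof -
    have h: "norm (w - z) > 0" using w by simp
    have G: "G w * norm (w - z) = K * (1 - a\<^sup>2) * norm (w - z)
        + K * (4 * a * C * norm (u w - u z)) * norm (w - z) + C * norm (R w)"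
      using h by (simp add: G_def field_simps)
    have split: "u w - u z = A (w - z) + R w" by (simp add: R_def)
    have up: "lp_norm p (u w) - a \<le> G w * norm (w - z)"
    proof -
      let ?l = "norming_functional p (u w)"
      define b where "b = ?l \<bullet> u z"
      have ba: "\<bar>b\<bar> \<le> a"
        unfolding b_def a_def by (rule abs_norming_functional_le[OF p])
      have "a - b = (a - lp_norm p (u w)) + ?l \<bullet> (u w - u z)"
        by (simp add: b_def inner_diff_right norming_functional_attains[OF p])
      also have "\<dots> \<le> 2 * C * norm (u w - u z)"
        using NC[of "u z" "u w"] lC[of "u w" "u w - u z"]
        by (simp add: a_def norm_minus_commute)
      finally have "(a - b) * (a + b) \<le> (2 * C * norm (u w - u z)) * (2 * a)"
        using ba a by (intro mult_mono) auto
      then have "1 - b\<^sup>2 \<le> 1 - a\<^sup>2 + 4 * a * C * norm (u w - u z)"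
        by (simp add: power2_eq_square algebra_simps)
      then have "K * (1 - b\<^sup>2) * norm (w - z) \<le> K * (1 - a\<^sup>2 + 4 * a * C * norm (u w - u z)) * norm (w - z)"
        using K by (intro mult_right_mono mult_left_mono) auto
      moreover have "?l \<bullet> A (w - z) \<le> K * (1 - b\<^sup>2) * norm (w - z)"
        using bound[of "u w" "w - z"] by (simp add: b_def)
      moreover have "lp_norm p (u w) - a \<le> ?l \<bullet> A (w - z) + ?l \<bullet> R w"
        using lp_norm_diff_le[OF p, of "u w" "u z"] unfolding split inner_add_right a_def .
      ultimately show ?thesis
        using lC[of "u w" "R w"] unfolding G by (simp add: algebra_simps)
    qed
    have down: "a - lp_norm p (u w) \<le> G w * norm (w - z)"
    proof -
      let ?l = "norming_functional p (u z)"
      have "a - lp_norm p (u w) \<le> ?l \<bullet> (u z - u w)"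
        unfolding a_def by (rule lp_norm_diff_le[OF p])
      also have "u z - u w = - A (w - z) - R w" by (simp add: R_def)
      also have "?l \<bullet> (- A (w - z) - R w) \<le> K * (1 - a\<^sup>2) * norm (w - z) + C * norm (R w)"
        using bound[of "u z" "w - z"] lC[of "u z" "R w"]
        by (simp add: inner_diff_right a_def norming_functional_attains[OF p])
      also have "\<dots> \<le> G w * norm (w - z)"
        unfolding G using K a by (simp add: C_def)
      finally show ?thesis .
    qed
    from up down show ?thesis
      using h by (simp add: a_def divide_le_eq norm_minus_commute)
  qed
  then have "\<forall>\<^sub>F w in at z. ereal (\<bar>lp_norm p (u z) - lp_norm p (u w)\<bar> / norm (z - w)) \<le> ereal (G w)"
    by (auto simp: eventually_at_filter)
  then have "grad_lp_norm p u z \<le> Limsup (at z) (\<lambda>w. ereal (G w))"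
    unfolding grad_lp_norm_def by (rule Limsup_mono)
  also have "Limsup (at z) (\<lambda>w. ereal (G w)) = ereal (K * (1 - a\<^sup>2))"
  proof (rule lim_imp_Limsup)
    have "((\<lambda>w. norm (R w) / norm (w - z)) \<longlongrightarrow> 0) (at z)"
      using A unfolding has_derivative_iff_norm R_def by simp
    moreover have "(u \<longlongrightarrow> u z) (at z)"
      using has_derivative_continuous[OF A] by (simp add: continuous_at)
    ultimately have "(G \<longlongrightarrow> K * (1 - a\<^sup>2 + 4 * a * C * norm (u z - u z)) + C * 0) (at z)"
      unfolding G_def by (intro tendsto_intros)
    then show "((\<lambda>w. ereal (G w)) \<longlongrightarrow> ereal (K * (1 - a\<^sup>2))) (at z)" by simp
  qed simp
  finally show ?thesis by (simp add: a_def)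
qed

section \<open>Complex slices of the ball and the gradient estimate\<close>

definition hermitian :: "complex ^ 'n \<Rightarrow> complex ^ 'n \<Rightarrow> complex" where
  "hermitian z e = (\<Sum>j\<in>UNIV. z $ j * cnj (e $ j))"

lemma norm_vec_power2:
  fixes x :: "'a::real_normed_vector ^ 'n"
  shows "(norm x)\<^sup>2 = (\<Sum>j\<in>UNIV. (norm (x $ j))\<^sup>2)"
  by (simp add: norm_vec_def L2_set_def sum_nonneg)

lemma norm_vector_smult:
  fixes x :: "'a::real_normed_div_algebra ^ 'n"
  shows "norm (c *s x) = norm c * norm x"
  by (simp add: norm_vec_def norm_mult L2_set_right_distrib)

text \<open>Completing the square.  The centre of the slice is the orthogonal projection of the origin onto
the complex line through \<open>z\<close> in the direction \<open>e\<close>.\<close>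

lemma norm_slice:
  fixes z e :: "complex ^ 'n"
  assumes e: "norm e = 1"
  shows "(norm (z + \<zeta> *s e))\<^sup>2 = (cmod (\<zeta> + hermitian z e))\<^sup>2 + (norm z)\<^sup>2 - (cmod (hermitian z e))\<^sup>2"
proof -
  have "(norm (z + \<zeta> *s e))\<^sup>2 = (\<Sum>j\<in>UNIV. (cmod (z $ j))\<^sup>2 + 2 * Re (cnj \<zeta> * (z $ j * cnj (e $ j))) + (cmod \<zeta>)\<^sup>2 * (cmod (e $ j))\<^sup>2)"
    unfolding norm_vec_power2
    by (intro sum.cong refl, unfold cmod_power2)
       (simp add: power2_eq_square algebra_simps)
  also have "\<dots> = (norm z)\<^sup>2 + 2 * Re (cnj \<zeta> * hermitian z e) + (cmod \<zeta>)\<^sup>2 * (norm e)\<^sup>2"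
    unfolding norm_vec_power2 hermitian_def
    by (simp only: sum.distrib sum_distrib_left Re_sum)
  also have "\<dots> = (cmod (\<zeta> + hermitian z e))\<^sup>2 + (norm z)\<^sup>2 - (cmod (hermitian z e))\<^sup>2"
    unfolding cmod_power2 by (simp add: e power2_eq_square algebra_simps)
  finally show ?thesis .
qed

text \<open>The identity for slices, read at the projection of the origin, contains the Cauchy--Schwarz
inequality.\<close>

lemma hermitian_le_norm:
  fixes z e :: "complex ^ 'n"
  assumes e: "norm e = 1"
  shows "cmod (hermitian z e) \<le> norm z"
proof -
  have "(cmod (hermitian z e))\<^sup>2 \<le> (norm z)\<^sup>2"
    using norm_slice[OF e, of z "- hermitian z e"] zero_le_power2[of "norm (z + (- hermitian z e) *s e)"] by simp
  then show ?thesis by (rule power2_le_imp_le) simp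
qed

lemma unit_direction:
  fixes z :: "'a::euclidean_space"
  obtains e where "norm e = 1" "z = norm z *\<^sub>R e"
proof (cases "z = 0")
  case True
  obtain b :: 'a where "norm b = 1" using vector_choose_size[of 1] by auto
  then show ?thesis using that True by auto
next
  case False
  then show ?thesis using that[of "z /\<^sub>R norm z"] by simp
qed

lemma boundary_dist_unit_ball:
  fixes z :: "'a::euclidean_space"
  assumes z: "z \<in> ball 0 1"
  shows "boundary_dist (ball 0 1) z = ereal (1 - norm z)"
  unfolding boundary_dist_def
proof (rule antisym)
  obtain w where w: "norm w = 1" and "z = norm z *\<^sub>R w" by (rule unit_direction)
  then have "z - w = (norm z - 1) *\<^sub>R w" by (metis scaleR_left_diff_distrib scaleR_one)
  then have "dist z w = 1 - norm z" using z w by (simp add: dist_norm)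
  then show "(INF w\<in>frontier (ball 0 1). ereal (dist z w)) \<le> ereal (1 - norm z)"
    using w by (intro INF_lower2[of w]) auto
  show "ereal (1 - norm z) \<le> (INF w\<in>frontier (ball 0 1). ereal (dist z w))"
  proof (rule INF_greatest)
    fix w :: 'a assume "w \<in> frontier (ball 0 1)"
    then have "norm w = 1" by simp
    then show "ereal (1 - norm z) \<le> ereal (dist z w)"
      using norm_triangle_ineq2[of w z] by (simp add: dist_norm norm_minus_commute)
  qed
qed

lemma slice_unit_ball:
  fixes z e :: "complex ^ 'n"
  assumes e: "norm e = 1" and z: "z \<in> ball 0 1"
  shows "z + \<zeta> *s e \<in> ball 0 1 \<longleftrightarrow>
     \<zeta> \<in> ball (- hermitian z e) (sqrt (1 - (norm z)\<^sup>2 + (cmod (hermitian z e))\<^sup>2))"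
proof -
  have "z + \<zeta> *s e \<in> ball 0 1 \<longleftrightarrow> (norm (z + \<zeta> *s e))\<^sup>2 < 1"
    by (simp add: power_less_one_iff)
  also have "\<dots> \<longleftrightarrow> (cmod (\<zeta> + hermitian z e))\<^sup>2 < 1 - (norm z)\<^sup>2 + (cmod (hermitian z e))\<^sup>2"
    unfolding norm_slice[OF e] by linarith
  also have "\<dots> \<longleftrightarrow> cmod (\<zeta> + hermitian z e) < sqrt (1 - (norm z)\<^sup>2 + (cmod (hermitian z e))\<^sup>2)"
    by (metis abs_of_nonneg norm_ge_zero real_sqrt_abs real_sqrt_less_iff)
  also have "cmod (\<zeta> + hermitian z e) = dist (- hermitian z e) \<zeta>"
    by (simp add: dist_norm norm_minus_commute add.commute)
  finally show ?thesis by simp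
qed

lemma pluriharmonic_slice_real_part:
  fixes f :: "complex ^ 'n \<Rightarrow> real"
  assumes f: "pluriharmonic_on (ball 0 1) (\<lambda>z. complex_of_real (f z))"
    and e: "norm e = 1" and S: "S = {\<zeta>. z + \<zeta> *s e \<in> ball 0 1}" "open S" "convex S"
  obtains F where "F holomorphic_on S" "\<And>\<zeta>. \<zeta> \<in> S \<Longrightarrow> Re (F \<zeta>) = f (z + \<zeta> *s e)"
proof -
  have loc: "\<exists>r>0. harmonic_on (ball \<zeta> r) (\<lambda>\<zeta>. f (z + \<zeta> *s e))" if "\<zeta> \<in> S" for \<zeta>
  proof -
    define z' where "z' = z + \<zeta> *s e"
    have z': "z' \<in> ball 0 1" using that by (simp add: z'_def S)
    have "harmonic_on {\<xi>. ereal (norm \<xi>) < boundary_dist (ball 0 1) z'} (\<lambda>\<xi>. complex_of_real (f (z' + \<xi> *s e)))"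
      using f z' e unfolding pluriharmonic_on_def by blast
    also have "{\<xi>. ereal (norm \<xi>) < boundary_dist (ball 0 1) z'} = ball (0::complex) (1 - norm z')"
      using boundary_dist_unit_ball[OF z'] by auto
    finally have "harmonic_on (ball 0 (1 - norm z')) (\<lambda>\<xi>. Re (complex_of_real (f (z' + \<xi> *s e))))"
      by (rule harmonic_on_bounded_linear_compose[OF bounded_linear_Re])
    then have "harmonic_on (ball 0 (1 - norm z')) (\<lambda>\<xi>. f (z + (\<zeta> + \<xi>) *s e))"
      by (simp add: z'_def vector_sadd_rdistrib add.assoc)
    then show ?thesis
      using z' harmonic_on_translate[of "1 - norm z'" "\<lambda>\<zeta>. f (z + \<zeta> *s e)" \<zeta>]
      by (intro exI[of _ "1 - norm z'"]) auto
  qed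
  show ?thesis by (rule harmonic_real_part_of_holomorphic[OF S(2,3) loc], assumption) (rule that)
qed

lemma pluriharmonic_map_differentiable:
  fixes u :: "complex ^ 'n \<Rightarrow> real ^ 'm"
  assumes "pluriharmonic_map_on S u" "z \<in> S"
  shows "u differentiable (at z)"
proof -
  have "(\<lambda>x. u x \<bullet> b) differentiable (at z)" if b: "b \<in> Basis" for b
  proof -
    obtain i where i: "b = axis i 1" using b by (auto simp: Basis_vec_def)
    have "C2_on S (\<lambda>x. complex_of_real (u x $ i))"
      using assms(1) by (simp add: pluriharmonic_map_on_def pluriharmonic_on_def)
    then obtain f' where "((\<lambda>x. complex_of_real (u x $ i)) has_derivative blinfun_apply (f' z)) (at z)"
      using assms(2) unfolding C2_on_def second_derivs_on_def by auto
    from bounded_linear.has_derivative[OF bounded_linear_Re this]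
    show ?thesis unfolding i by (auto simp: inner_axis differentiable_def)
  qed
  then show ?thesis by (subst differentiable_componentwise_within) blast
qed

text \<open>The Schwarz--Pick estimate for the real pluriharmonic function \<open>l \<bullet> u\<close>, applied on the slice of
the ball through \<open>z\<close> in the direction of \<open>h\<close>.\<close>

lemma pluriharmonic_functional_derivative_bound:
  fixes u :: "complex ^ 'n \<Rightarrow> real ^ 'm"
  assumes u: "pluriharmonic_map_on (ball 0 1) u"
    and l: "\<And>w. w \<in> ball 0 1 \<Longrightarrow> \<bar>l \<bullet> u w\<bar> < 1"
    and z: "z \<in> ball 0 1" and A: "(u has_derivative A) (at z)"
  shows "\<bar>l \<bullet> A h\<bar> \<le> 4 / pi / (1 - (norm z)\<^sup>2) * (1 - (l \<bullet> u z)\<^sup>2) * norm h"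
proof (cases "h = 0")
  case True
  then show ?thesis using has_derivative_linear[OF A] by (simp add: linear_0)
next
  case False
  define e where "e = h /\<^sub>R norm h"
  have e: "norm e = 1" and he: "h = norm h *\<^sub>R e" using False by (simp_all add: e_def)
  define s where "s = hermitian z e"
  define r where "r = sqrt (1 - (norm z)\<^sup>2 + (cmod s)\<^sup>2)"
  define S where "S = {\<zeta>. z + \<zeta> *s e \<in> ball 0 1}"
  have S: "S = ball (- s) r"
    unfolding S_def r_def s_def slice_unit_ball[OF e z] by (rule Collect_mem_eq)
  have z1: "(norm z)\<^sup>2 < 1" using z by (simp add: power_less_one_iff)
  have r2: "r\<^sup>2 = 1 - (norm z)\<^sup>2 + (cmod s)\<^sup>2"
    unfolding r_def using z1 by (intro real_sqrt_pow2) (simp add: add_nonneg_nonneg)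
  have "cmod s \<le> norm z" unfolding s_def by (rule hermitian_le_norm[OF e])
  then have "(cmod s)\<^sup>2 \<le> (norm z)\<^sup>2" by (intro power_mono) auto
  \<comment> \<open>The slices through \<open>z\<close> of largest radius \<open>r = 1\<close>, those through the origin, are the worst case.\<close>
  then have r1: "r \<le> 1" unfolding r_def by simp
  have "\<exists>F. F holomorphic_on S \<and> (\<forall>\<zeta>\<in>S. Re (F \<zeta>) = u (z + \<zeta> *s e) $ i)" for i
  proof -
    have "pluriharmonic_on (ball 0 1) (\<lambda>z. complex_of_real (u z $ i))"
      using u by (simp add: pluriharmonic_map_on_def)
    from pluriharmonic_slice_real_part[OF this e S_def] show ?thesis
      unfolding S by (metis open_ball convex_ball)
  qed
  then obtain F where F: "\<And>i. F i holomorphic_on S" "\<And>i \<zeta>. \<zeta> \<in> S \<Longrightarrow> Re (F i \<zeta>) = u (z + \<zeta> *s e) $ i"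
    by metis
  define \<Phi> where "\<Phi> \<zeta> = (\<Sum>i\<in>UNIV. of_real (l $ i) * F i \<zeta>)" for \<zeta>
  have hol: "\<Phi> holomorphic_on ball (- s) r"
    unfolding \<Phi>_def S[symmetric] by (intro holomorphic_intros F)
  have Re\<Phi>: "Re (\<Phi> \<zeta>) = l \<bullet> u (z + \<zeta> *s e)" if "\<zeta> \<in> S" for \<zeta>
    using that by (simp add: \<Phi>_def inner_vec_def F)
  have 0: "0 \<in> S" using z by (simp add: S_def)
  have strip: "\<bar>Re (\<Phi> \<zeta>)\<bar> < 1" if "\<zeta> \<in> ball (- s) r" for \<zeta>
  proof -
    have "\<zeta> \<in> S" using that S by simp
    then show ?thesis using l by (simp add: Re\<Phi> S_def)
  qed
  have "cmod (deriv \<Phi> 0) \<le> 4 / pi * cos (pi / 2 * Re (\<Phi> 0)) * (r / (r\<^sup>2 - (cmod (0 - - s))\<^sup>2))"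
    using 0 S by (intro strip_Schwarz_Pick hol strip) auto
  also have "r\<^sup>2 - (cmod (0 - - s))\<^sup>2 = 1 - (norm z)\<^sup>2" by (simp add: r2)
  also have "4 / pi * cos (pi / 2 * Re (\<Phi> 0)) * (r / (1 - (norm z)\<^sup>2))
      \<le> 4 / pi * (1 - (Re (\<Phi> 0))\<^sup>2) * (1 / (1 - (norm z)\<^sup>2))"
  proof -
    have "\<bar>Re (\<Phi> 0)\<bar> < 1" using strip 0 S by blast
    then have "cos (pi / 2 * Re (\<Phi> 0)) \<le> 1 - (Re (\<Phi> 0))\<^sup>2" "0 < cos (pi / 2 * Re (\<Phi> 0))"
      using cos_half_pi_le[of "Re (\<Phi> 0)"] cos_strip_pos[of "Re (\<Phi> 0)"] by simp_all
    moreover have "0 \<le> r" using 0 S by (metis ball_eq_empty empty_iff not_le less_imp_le)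
    ultimately show ?thesis using r1 z1
      by (intro mult_mono divide_right_mono mult_left_mono) auto
  qed
  finally have b: "cmod (deriv \<Phi> 0) \<le> 4 / pi / (1 - (norm z)\<^sup>2) * (1 - (l \<bullet> u z)\<^sup>2)"
    using Re\<Phi>[OF 0] by (simp add: mult_ac)
  have "(\<Phi> has_field_derivative deriv \<Phi> 0) (at 0)"
    using holomorphic_derivI[OF hol open_ball] 0 S by blast
  then have "((\<lambda>\<zeta>. Re (\<Phi> \<zeta>)) has_derivative (\<lambda>k. Re (deriv \<Phi> 0 * k))) (at 0)"
    unfolding has_field_derivative_def by (intro derivative_intros)
  \<comment> \<open>The derivative of the slice function, from \<open>\<Phi>\<close> here and from \<open>A\<close> in \<open>d2\<close>; comparing the two
    at the direction \<open>1\<close> expresses \<open>l \<bullet> A e\<close> through \<open>deriv \<Phi> 0\<close>.\<close>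
  then have d1: "((\<lambda>\<zeta>. l \<bullet> u (z + \<zeta> *s e)) has_derivative (\<lambda>k. Re (deriv \<Phi> 0 * k))) (at 0)"
    by (rule has_derivative_transform_within_open[OF _ _ 0]) (simp_all add: S Re\<Phi>[unfolded S])
  have "bounded_linear (\<lambda>\<zeta>. \<zeta> *s e)"
    by (intro bounded_linear_intro[where K = "norm e"])
       (auto simp: vec_eq_iff algebra_simps norm_vector_smult)
  then have "((\<lambda>\<zeta>. z + \<zeta> *s e) has_derivative (\<lambda>k. k *s e)) (at 0)"
    by (auto intro!: derivative_eq_intros bounded_linear_imp_has_derivative)
  moreover have "(u has_derivative A) (at (z + 0 *s e))" using A by simp
  ultimately have "((\<lambda>\<zeta>. u (z + \<zeta> *s e)) has_derivative (\<lambda>k. A (k *s e))) (at 0)"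
    by (rule has_derivative_compose)
  then have d2: "((\<lambda>\<zeta>. l \<bullet> u (z + \<zeta> *s e)) has_derivative (\<lambda>k. l \<bullet> A (k *s e))) (at 0)"
    by (intro derivative_intros)
  have "l \<bullet> A (1 *s e) = Re (deriv \<Phi> 0 * 1)"
    using has_derivative_unique[OF d1 d2] by metis
  then have "\<bar>l \<bullet> A e\<bar> \<le> cmod (deriv \<Phi> 0)" using abs_Re_le_cmod by simp
  also note b
  finally have "norm h * \<bar>l \<bullet> A e\<bar> \<le> norm h * (4 / pi / (1 - (norm z)\<^sup>2) * (1 - (l \<bullet> u z)\<^sup>2))"
    by (rule mult_left_mono) simp
  moreover have "A h = norm h *\<^sub>R A e"
    by (subst he) (rule linear_scale[OF has_derivative_linear[OF A]])
  ultimately show ?thesis by (simp add: abs_mult mult_ac)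
qed

text \<open>The functionals that norm the values of \<open>u\<close> lie in the dual unit ball, so they map \<open>u\<close> to scalar
functions with values in \<open>(-1, 1)\<close>, to which the scalar estimate applies.\<close>

theorem Schwarz_Pick_lp_norm:
  fixes u :: "complex ^ 'n \<Rightarrow> real ^ 'm"
  assumes p: "1 < p" and u: "pluriharmonic_map_on (ball 0 1) u"
    and sub: "u ` ball 0 1 \<subseteq> lp_unit_ball p" and z: "z \<in> ball 0 1"
  shows "grad_lp_norm p u z \<le> ereal (4 / pi * ((1 - (lp_norm p (u z))\<^sup>2) / (1 - (norm z)\<^sup>2)))"
proof -
  obtain A where A: "(u has_derivative A) (at z)"
    using pluriharmonic_map_differentiable[OF u z] unfolding differentiable_def by blast
  have "\<bar>norming_functional p x \<bullet> u w\<bar> < 1" if "w \<in> ball 0 1" for x w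
    using abs_norming_functional_le[OF p, of x "u w"] sub that unfolding lp_unit_ball_def by force
  from pluriharmonic_functional_derivative_bound[OF u this z A]
  have "grad_lp_norm p u z \<le> ereal (4 / pi / (1 - (norm z)\<^sup>2) * (1 - (lp_norm p (u z))\<^sup>2))"
    using z by (intro grad_lp_norm_le[OF p A]) (auto simp: power_le_one_iff)
  then show ?thesis by (simp add: mult_ac)
qed

section \<open>Pluriharmonic functions from holomorphic ones\<close>

text \<open>The derivative of \<open>x \<mapsto> T (F (a + L x))\<close> when the complex derivative of \<open>F\<close> is \<open>c\<close>.  As this is a
bounded linear function of \<open>c\<close>, it may take the place of \<open>T\<close> itself, and so the same formula
describes the second derivative.\<close>

definition mult_blinfun :: "(complex \<Rightarrow> 'b::real_normed_vector) \<Rightarrow> ('a::real_normed_vector \<Rightarrow> complex)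
    \<Rightarrow> complex \<Rightarrow> 'a \<Rightarrow>\<^sub>L 'b" where
  "mult_blinfun T L c = Blinfun (\<lambda>h. T (c * L h))"

lemma mult_blinfun_apply:
  assumes "bounded_linear T" "bounded_linear L"
  shows "blinfun_apply (mult_blinfun T L c) h = T (c * L h)"
proof -
  have "bounded_linear (\<lambda>h. T (c * L h))"
    using assms by (intro bounded_linear_compose[OF assms(1)] bounded_linear_mult_const bounded_linear_const_mult)
  then show ?thesis unfolding mult_blinfun_def by (simp add: bounded_linear_Blinfun_apply)
qed

lemma bounded_linear_mult_blinfun:
  assumes T: "bounded_linear T" and L: "bounded_linear L"
  shows "bounded_linear (mult_blinfun T L)"
proof -
  interpret T: bounded_linear T by fact
  obtain K where K: "\<And>x. norm (T x) \<le> norm x * K" "K > 0" using T.pos_bounded by blast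
  interpret L: bounded_linear L by fact
  obtain M where M: "\<And>x. norm (L x) \<le> norm x * M" "M > 0" using L.pos_bounded by blast
  show ?thesis
  proof (rule bounded_linear_intro[where K = "K * M"])
    fix b c :: complex and r :: real
    show "mult_blinfun T L (b + c) = mult_blinfun T L b + mult_blinfun T L c"
      by (rule blinfun_eqI) (simp add: mult_blinfun_apply[OF T L] blinfun.add_left distrib_right T.add)
    show "mult_blinfun T L (r *\<^sub>R c) = r *\<^sub>R mult_blinfun T L c"
      by (rule blinfun_eqI) (simp add: mult_blinfun_apply[OF T L] blinfun.scaleR_left T.scaleR)
    show "norm (mult_blinfun T L c) \<le> norm c * (K * M)"
    proof (rule norm_blinfun_bound)
      fix h
      have "norm (T (c * L h)) \<le> norm (c * L h) * K" by (rule K)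
      also have "\<dots> \<le> norm c * (norm h * M) * K"
        unfolding norm_mult using K M by (intro mult_right_mono mult_left_mono) auto
      finally show "norm (blinfun_apply (mult_blinfun T L c) h) \<le> norm c * (K * M) * norm h"
        by (simp add: mult_blinfun_apply[OF T L] mult_ac)
    qed (use K M in auto)
  qed
qed

lemma has_derivative_holomorphic_affine:
  assumes T: "bounded_linear T" and L: "bounded_linear L"
    and F: "(F has_field_derivative c) (at (a + L x))"
  shows "((\<lambda>x. T (F (a + L x))) has_derivative blinfun_apply (mult_blinfun T L c)) (at x)"
proof -
  have "((\<lambda>x. a + L x) has_derivative L) (at x)"
    using bounded_linear_imp_has_derivative[OF L] by (auto intro!: derivative_eq_intros)
  from has_derivative_compose[OF this F[unfolded has_field_derivative_def]]
  have "((\<lambda>x. F (a + L x)) has_derivative (\<lambda>h. c * L h)) (at x)" .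
  from bounded_linear.has_derivative[OF T this] show ?thesis
    by (rule has_derivative_eq_rhs) (simp add: fun_eq_iff mult_blinfun_apply[OF T L])
qed

text \<open>The first derivative has the same shape as the function, with \<open>deriv F\<close> in place of \<open>F\<close> and
\<open>mult_blinfun T L\<close> in place of \<open>T\<close>; hence the chain rule is used twice in the same form.\<close>

lemma second_derivs_on_holomorphic_affine:
  fixes T :: "complex \<Rightarrow> 'b::real_normed_vector" and L :: "'a::real_normed_vector \<Rightarrow> complex"
  assumes T: "bounded_linear T" and L: "bounded_linear L"
    and F: "F holomorphic_on \<Omega>" and \<Omega>: "open \<Omega>"
    and S: "open S" "\<And>x. x \<in> S \<Longrightarrow> a + L x \<in> \<Omega>"
  shows "second_derivs_on S (\<lambda>x. T (F (a + L x)))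
           (\<lambda>x. mult_blinfun T L (deriv F (a + L x)))
           (\<lambda>x. mult_blinfun (mult_blinfun T L) L (deriv (deriv F) (a + L x)))"
  unfolding second_derivs_on_def
proof (intro conjI ballI)
  note TL = bounded_linear_mult_blinfun[OF T L]
  have F': "deriv F holomorphic_on \<Omega>" by (rule holomorphic_deriv[OF F \<Omega>])
  show "open S" by fact
  fix x assume x: "x \<in> S"
  show "((\<lambda>x. T (F (a + L x))) has_derivative blinfun_apply (mult_blinfun T L (deriv F (a + L x)))) (at x)"
    by (rule has_derivative_holomorphic_affine[OF T L holomorphic_derivI[OF F \<Omega> S(2)[OF x]]])
  show "((\<lambda>x. mult_blinfun T L (deriv F (a + L x))) has_derivative
      blinfun_apply (mult_blinfun (mult_blinfun T L) L (deriv (deriv F) (a + L x)))) (at x)"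
    by (rule has_derivative_holomorphic_affine[OF TL L holomorphic_derivI[OF F' \<Omega> S(2)[OF x]]])
next
  note TLL = bounded_linear_mult_blinfun[OF bounded_linear_mult_blinfun[OF T L] L]
  have "deriv (deriv F) holomorphic_on \<Omega>" by (intro holomorphic_deriv F \<Omega>)
  then have "continuous_on \<Omega> (deriv (deriv F))" by (rule holomorphic_on_imp_continuous_on)
  moreover have "continuous_on S (\<lambda>x. a + L x)"
    by (intro continuous_on_add continuous_on_const linear_continuous_on L)
  ultimately have "continuous_on S (\<lambda>x. deriv (deriv F) (a + L x))"
    by (rule continuous_on_compose2) (use S in auto)
  then show "continuous_on S (\<lambda>x. mult_blinfun (mult_blinfun T L) L (deriv (deriv F) (a + L x)))"
    by (rule bounded_linear.continuous_on[OF TLL])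
qed

text \<open>On a complex line the second derivative at \<open>c\<close> in the directions \<open>h, h\<close> is \<open>T\<close> applied to
\<open>c (h L \<theta>)\<^sup>2\<close>, and \<open>1\<^sup>2 + \<i>\<^sup>2 = 0\<close> makes the Laplacian vanish.\<close>

lemma pluriharmonic_on_holomorphic_linear:
  fixes L :: "complex ^ 'n \<Rightarrow> complex"
  assumes T: "bounded_linear T" and L: "bounded_linear L" "\<And>c x. L (c *s x) = c * L x"
    and F: "F holomorphic_on \<Omega>" and \<Omega>: "open \<Omega>"
    and S: "\<And>x. x \<in> S \<Longrightarrow> L x \<in> \<Omega>" "open S"
    and bd: "\<And>z \<theta> \<zeta>. z \<in> S \<Longrightarrow> norm \<theta> = 1 \<Longrightarrow> ereal (norm \<zeta>) < boundary_dist S z \<Longrightarrow> z + \<zeta> *s \<theta> \<in> S"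
  shows "pluriharmonic_on S (\<lambda>x. T (F (L x)))"
  unfolding pluriharmonic_on_def
proof (intro conjI ballI allI impI)
  show "C2_on S (\<lambda>x. T (F (L x)))"
    using second_derivs_on_holomorphic_affine[OF T L(1) F \<Omega> S(2), of 0] S(1)
    unfolding C2_on_def by auto
  fix z \<theta> :: "complex ^ 'n" assume z: "z \<in> S" and \<theta>: "norm \<theta> = 1"
  let ?D = "{\<zeta>. ereal (cmod \<zeta>) < boundary_dist S z}"
  define M where "M \<zeta> = \<zeta> * L \<theta>" for \<zeta>
  have M: "bounded_linear M" unfolding M_def by (rule bounded_linear_mult_left)
  have "open ?D"
    by (intro open_Collect_less continuous_intros)
  moreover have LM: "L (z + \<zeta> *s \<theta>) = L z + M \<zeta>" for \<zeta>
    by (simp add: M_def L(2) linear_add[OF bounded_linear.linear[OF L(1)]])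
  have "L z + M \<zeta> \<in> \<Omega>" if "\<zeta> \<in> ?D" for \<zeta>
    using S(1)[OF bd[OF z \<theta>, of \<zeta>]] that by (simp add: LM)
  ultimately have "second_derivs_on ?D (\<lambda>\<zeta>. T (F (L z + M \<zeta>)))
           (\<lambda>\<zeta>. mult_blinfun T M (deriv F (L z + M \<zeta>)))
           (\<lambda>\<zeta>. mult_blinfun (mult_blinfun T M) M (deriv (deriv F) (L z + M \<zeta>)))"
    by (intro second_derivs_on_holomorphic_affine[OF T M F \<Omega>]) auto
  moreover have "(\<Sum>b\<in>Basis. mult_blinfun (mult_blinfun T M) M c b b) = 0" for c
  proof -
    have "T (c * M \<i> * M \<i>) = T (- (c * M 1 * M 1))" by (simp add: M_def algebra_simps)
    also have "\<dots> = - T (c * M 1 * M 1)" by (rule linear_neg[OF bounded_linear.linear[OF T]])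
    finally show ?thesis
      by (simp add: Basis_complex_def mult_blinfun_apply[OF bounded_linear_mult_blinfun[OF T M] M]
           mult_blinfun_apply[OF T M])
  qed
  ultimately show "harmonic_on ?D (\<lambda>\<zeta>. T (F (L (z + \<zeta> *s \<theta>))))"
    unfolding harmonic_on_def LM by blast
qed

section \<open>The extremal map\<close>

text \<open>The conformal map of the unit disc onto the strip \<open>\<bar>Im w\<bar> < \<pi> / 2\<close> that preserves the real axis.\<close>

definition strip_Cayley :: "complex \<Rightarrow> complex" where
  "strip_Cayley \<omega> = Ln ((1 + \<omega>) / (1 - \<omega>))"

lemma Re_Cayley_pos:
  assumes "cmod \<omega> < 1" shows "Re ((1 + \<omega>) / (1 - \<omega>)) > 0" "1 - \<omega> \<noteq> 0"
proof -
  show nz: "1 - \<omega> \<noteq> 0" using assms by auto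
  have "Re ((1 + \<omega>) / (1 - \<omega>)) = (1 - (cmod \<omega>)\<^sup>2) / (cmod (1 - \<omega>))\<^sup>2"
    unfolding Re_divide cmod_power2 by (simp add: power2_eq_square algebra_simps)
  also have "\<dots> > 0"
    using nz assms by (simp add: power_less_one_iff)
  finally show "Re ((1 + \<omega>) / (1 - \<omega>)) > 0" .
qed

lemma strip_Cayley_derivative:
  assumes "cmod \<omega> < 1"
  shows "(strip_Cayley has_field_derivative 2 / (1 - \<omega>\<^sup>2)) (at \<omega>)"
proof -
  have nz: "1 - \<omega> \<noteq> 0" "1 + \<omega> \<noteq> 0"
    using Re_Cayley_pos[OF assms] by auto
  have "(1 + \<omega>) / (1 - \<omega>) \<notin> \<real>\<^sub>\<le>\<^sub>0"
    using Re_Cayley_pos(1)[OF assms] by (auto simp: complex_nonpos_Reals_iff)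
  moreover have "((\<lambda>\<omega>. (1 + \<omega>) / (1 - \<omega>)) has_field_derivative 2 / (1 - \<omega>)\<^sup>2) (at \<omega>)"
    using nz by (auto intro!: derivative_eq_intros simp: power2_eq_square field_simps)
  ultimately have "(strip_Cayley has_field_derivative 2 / (1 - \<omega>)\<^sup>2 / ((1 + \<omega>) / (1 - \<omega>))) (at \<omega>)"
    unfolding strip_Cayley_def
    by (auto intro!: derivative_eq_intros simp: power2_eq_square mult_ac)
  moreover have "2 / (1 - \<omega>)\<^sup>2 / ((1 + \<omega>) / (1 - \<omega>)) = 2 / (1 - \<omega>\<^sup>2)"
  proof -
    have "2 / a\<^sup>2 / (b / a) = 2 / (a * b)" if "a \<noteq> 0" for a b :: complex
      using that by (simp add: power2_eq_square)
    moreover have "1 - \<omega>\<^sup>2 = (1 - \<omega>) * (1 + \<omega>)"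
      by (simp add: power2_eq_square algebra_simps)
    ultimately show ?thesis using nz(1) by metis
  qed
  ultimately show ?thesis by simp
qed

lemma strip_Cayley_bound:
  assumes "cmod \<omega> < 1" shows "\<bar>2 / pi * Im (strip_Cayley \<omega>)\<bar> < 1"
  using Re_Ln_pos_lt_imp[OF Re_Cayley_pos(1)[OF assms]]
  by (simp add: strip_Cayley_def abs_mult field_simps)

lemma Im_strip_Cayley_of_real:
  assumes "\<bar>t\<bar> < 1" shows "Im (strip_Cayley (of_real t)) = 0"
proof -
  have eq: "(1 + complex_of_real t) / (1 - of_real t) = of_real ((1 + t) / (1 - t))" by simp
  have pos: "(1 + t) / (1 - t) > 0" using assms by (intro divide_pos_pos) (auto simp: abs_less_iff)
  show ?thesis unfolding strip_Cayley_def eq Ln_of_real[OF pos] by simp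
qed

text \<open>A limit superior along a curve is a lower bound for the full limit superior.\<close>

lemma Limsup_filterlim_le:
  fixes g :: "'b \<Rightarrow> 'c::complete_linorder"
  assumes "filterlim \<gamma> G F"
  shows "Limsup F (\<lambda>t. g (\<gamma> t)) \<le> Limsup G g"
proof -
  have "Limsup F (\<lambda>t. g (\<gamma> t)) \<le> Limsup (filtermap \<gamma> F) g"
    by (rule Limsup_filtermap_ge)
  also have "\<dots> \<le> Limsup G g"
    unfolding Limsup_def using assms
    by (intro INF_superset_mono) (auto simp: filterlim_def le_filter_def)
  finally show ?thesis .
qed

lemma hermitian_smult: "hermitian (c *s x) e = c * hermitian x e"
  by (simp add: hermitian_def sum_distrib_left mult.assoc)

lemma bounded_linear_hermitian:
  fixes e :: "complex ^ 'n"
  assumes "norm e = 1"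
  shows "bounded_linear (\<lambda>x. hermitian x e)"
  using hermitian_le_norm[OF assms]
  by (intro bounded_linear_intro[where K = 1])
     (auto simp: hermitian_def sum.distrib distrib_right scaleR_sum_right)

lemma hermitian_self: "hermitian e e = of_real ((norm e)\<^sup>2)"
  by (simp add: hermitian_def norm_vec_power2 complex_norm_square flip: of_real_power)

lemma extremal_pluriharmonic_map:
  fixes e :: "complex ^ 'n" and j :: "'m::finite"
  assumes e: "norm e = 1"
  shows "pluriharmonic_map_on (ball 0 1)
           (\<lambda>w. axis j (2 / pi * Im (strip_Cayley (hermitian w e))) :: real ^ 'm)"
  unfolding pluriharmonic_map_on_def
proof
  fix i
  define T where "T x = complex_of_real (if i = j then 2 / pi * Im x else 0)" for x
  have T: "bounded_linear T"
  proof (cases "i = j")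
    case True
    then have "T = (\<lambda>x. of_real (2 / pi * Im x))" by (simp add: T_def fun_eq_iff)
    moreover have "bounded_linear (\<lambda>x. complex_of_real (2 / pi * Im x))"
      by (intro bounded_linear_compose[OF bounded_linear_of_real] bounded_linear_const_mult bounded_linear_Im)
    ultimately show ?thesis by simp
  next
    case False
    then have "T = (\<lambda>x. 0)" by (simp add: T_def fun_eq_iff)
    then show ?thesis by simp
  qed
  have "strip_Cayley holomorphic_on ball 0 1"
    by (subst holomorphic_on_open) (auto intro!: exI strip_Cayley_derivative)
  moreover have "z + \<zeta> *s \<theta> \<in> ball 0 1"
    if "z \<in> ball 0 1" "norm \<theta> = 1" "ereal (norm \<zeta>) < boundary_dist (ball 0 1) z"
    for z \<theta> :: "complex ^ 'n" and \<zeta>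
    using that norm_triangle_ineq[of z "\<zeta> *s \<theta>"] boundary_dist_unit_ball[OF that(1)]
    by (simp add: norm_vector_smult)
  ultimately have "pluriharmonic_on (ball 0 1) (\<lambda>w. T (strip_Cayley (hermitian w e)))"
    using le_less_trans[OF hermitian_le_norm[OF e]]
    by (intro pluriharmonic_on_holomorphic_linear[OF T bounded_linear_hermitian[OF e] hermitian_smult,
          where \<Omega> = "ball 0 1"]) auto
  then show "pluriharmonic_on (ball 0 1)
      (\<lambda>w. complex_of_real ((axis j (2 / pi * Im (strip_Cayley (hermitian w e))) :: real ^ 'm) $ i))"
    by (simp only: T_def axis_def vec_lambda_beta)
qed

text \<open>Along the curve \<open>z + \<i> t e\<close> the argument of \<open>strip_Cayley\<close> is \<open>a + \<i> t\<close>.  It crosses the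
real diameter, on which the imaginary part vanishes, orthogonally, so the whole derivative
\<open>2 / (1 - a\<^sup>2)\<close> of \<open>strip_Cayley\<close> is seen by the imaginary part.\<close>

lemma extremal_grad_ge:
  fixes e :: "complex ^ 'n" and j :: "'m::finite"
  assumes p: "p > 0" and e: "norm e = 1" and z: "z = a *\<^sub>R e" "0 \<le> a" "a < 1"
  shows "ereal (4 / pi / (1 - a\<^sup>2)) \<le> grad_lp_norm p
           (\<lambda>w. axis j (2 / pi * Im (strip_Cayley (hermitian w e))) :: real ^ 'm) z"
proof -
  define U where "U w = 2 / pi * Im (strip_Cayley (hermitian w e))" for w
  define \<gamma> where "\<gamma> t = z + (\<i> * of_real t) *s e" for t :: real
  have ze: "z = of_real a *s e" unfolding z by (simp add: vec_eq_iff scaleR_conv_of_real[where 'a = complex])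
  have hz: "hermitian z e = of_real a"
    unfolding ze hermitian_smult hermitian_self using e by simp
  have U\<gamma>: "U (\<gamma> t) = 2 / pi * Im (strip_Cayley (of_real a + \<i> * of_real t))" for t
    unfolding U_def \<gamma>_def
    by (simp add: linear_add[OF bounded_linear.linear[OF bounded_linear_hermitian[OF e]]]
          hz hermitian_smult hermitian_self e)
  have Uz: "U z = 0" unfolding U_def hz using z Im_strip_Cayley_of_real[of a] by simp
  have \<gamma>n: "norm (z - \<gamma> t) = \<bar>t\<bar>" for t
    by (simp add: \<gamma>_def norm_vector_smult norm_mult e)
  have "(strip_Cayley has_field_derivative 2 / (1 - (of_real a)\<^sup>2)) (at (of_real a + \<i> * of_real 0))"
    using strip_Cayley_derivative[of "of_real a"] z by simp
  moreover have "((\<lambda>t. of_real a + \<i> * of_real t) has_vector_derivative \<i>) (at 0)"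
    by (auto intro!: derivative_eq_intros)
  ultimately have sc: "((\<lambda>t. strip_Cayley (of_real a + \<i> * of_real t)) has_vector_derivative \<i> * (2 / (1 - (of_real a)\<^sup>2))) (at 0)"
    using field_vector_diff_chain_at[of "\<lambda>t. of_real a + \<i> * of_real t" \<i> 0 strip_Cayley
        "2 / (1 - (of_real a)\<^sup>2)"]
    by (simp add: o_def)
  have val: "Im (\<i> * (2 / (1 - (complex_of_real a)\<^sup>2))) = 2 / (1 - a\<^sup>2)"
  proof -
    have "2 / (1 - (complex_of_real a)\<^sup>2) = of_real (2 / (1 - a\<^sup>2))" by simp
    then show ?thesis by (metis Im_i_times Re_complex_of_real)
  qed
  from bounded_linear.has_vector_derivative[OF bounded_linear_Im sc, unfolded val]
  have "((\<lambda>t. Im (strip_Cayley (of_real a + \<i> * of_real t))) has_real_derivative 2 / (1 - a\<^sup>2)) (at 0)"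
    unfolding has_real_derivative_iff_has_vector_derivative .
  then have "((\<lambda>t. U (\<gamma> t)) has_real_derivative 2 / pi * (2 / (1 - a\<^sup>2))) (at 0)"
    unfolding U\<gamma> by (rule DERIV_cmult)
  then have "((\<lambda>t. U (\<gamma> t) / t) \<longlongrightarrow> 2 / pi * (2 / (1 - a\<^sup>2))) (at 0)"
    using Uz by (simp add: has_field_derivative_iff \<gamma>_def)
  then have "((\<lambda>t. \<bar>U (\<gamma> t) / t\<bar>) \<longlongrightarrow> \<bar>2 / pi * (2 / (1 - a\<^sup>2))\<bar>) (at_right 0)"
    by (intro tendsto_rabs) (rule filterlim_at_split[THEN iffD1, THEN conjunct2])
  moreover have "2 / pi * (2 / (1 - a\<^sup>2)) \<ge> 0"
    using z by (simp add: power_le_one)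
  ultimately have lim: "((\<lambda>t. ereal \<bar>U (\<gamma> t) / t\<bar>) \<longlongrightarrow> ereal (4 / pi / (1 - a\<^sup>2))) (at_right 0)"
    by simp
  have \<gamma>_lim: "filterlim \<gamma> (at z) (at_right 0)"
    unfolding filterlim_at
  proof
    show "\<forall>\<^sub>F t in at_right 0. \<gamma> t \<in> UNIV \<and> \<gamma> t \<noteq> z"
    proof (rule eventually_at_right_less[THEN eventually_mono])
      fix t :: real assume "0 < t"
      then show "\<gamma> t \<in> UNIV \<and> \<gamma> t \<noteq> z" using \<gamma>n[of t] by auto
    qed
    have "((\<lambda>t::real. \<bar>t\<bar>) \<longlongrightarrow> 0) (at_right 0)"
      by (rule tendsto_rabs_zero) (rule tendsto_ident_at)
    then show "(\<gamma> \<longlongrightarrow> z) (at_right 0)"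
      by (subst tendsto_dist_iff) (simp add: dist_norm norm_minus_commute \<gamma>n)
  qed
  have "ereal (4 / pi / (1 - a\<^sup>2)) = Limsup (at_right 0) (\<lambda>t. ereal \<bar>U (\<gamma> t) / t\<bar>)"
    by (rule lim_imp_Limsup[symmetric, OF _ lim]) simp
  also have "\<dots> = Limsup (at_right 0) (\<lambda>t. ereal (\<bar>lp_norm p (axis j (U z) :: real ^ 'm) - lp_norm p (axis j (U (\<gamma> t)) :: real ^ 'm)\<bar> / norm (z - \<gamma> t)))"
    by (simp add: lp_norm_axis[OF p] Uz \<gamma>n)
  also have "\<dots> \<le> grad_lp_norm p (\<lambda>w. axis j (U w) :: real ^ 'm) z"
    unfolding grad_lp_norm_def by (rule Limsup_filterlim_le[OF \<gamma>_lim])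
  finally show ?thesis by (simp add: U_def)
qed

theorem theorem2p3:
  fixes p :: real
  assumes "1 < p"
  shows "(\<forall>u :: complex ^ 'n \<Rightarrow> real ^ 'm.
            pluriharmonic_map_on (ball 0 1) u \<and> u ` ball 0 1 \<subseteq> lp_unit_ball p \<longrightarrow>
            (\<forall>z\<in>ball 0 1.
               grad_lp_norm p u z
                 \<le> ereal (4 / pi * ((1 - (lp_norm p (u z))\<^sup>2) / (1 - (norm z)\<^sup>2))))) \<and>
         (\<forall>z\<in>ball 0 1. \<exists>u :: complex ^ 'n \<Rightarrow> real ^ 'm.
            pluriharmonic_map_on (ball 0 1) u \<and> u ` ball 0 1 \<subseteq> lp_unit_ball p \<and>
            grad_lp_norm p u z
              = ereal (4 / pi * ((1 - (lp_norm p (u z))\<^sup>2) / (1 - (norm z)\<^sup>2))))"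
proof (intro conjI allI impI ballI)
  fix u :: "complex ^ 'n \<Rightarrow> real ^ 'm" and z :: "complex ^ 'n"
  assume "pluriharmonic_map_on (ball 0 1) u \<and> u ` ball 0 1 \<subseteq> lp_unit_ball p" and "z \<in> ball 0 1"
  then show "grad_lp_norm p u z \<le> ereal (4 / pi * ((1 - (lp_norm p (u z))\<^sup>2) / (1 - (norm z)\<^sup>2)))"
    using Schwarz_Pick_lp_norm[OF assms] by blast
next
  fix z :: "complex ^ 'n" assume z: "z \<in> ball 0 1"
  have p: "p > 0" using assms by simp
  obtain e where e: "norm e = 1" "z = norm z *\<^sub>R e" by (rule unit_direction)
  define j where "j = (undefined :: 'm)"
  define U where "U w = 2 / pi * Im (strip_Cayley (hermitian w e))" for w
  define u where "u w = (axis j (U w) :: real ^ 'm)" for w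
  have u: "pluriharmonic_map_on (ball 0 1) u"
    unfolding u_def U_def by (rule extremal_pluriharmonic_map[OF e(1)])
  have "\<bar>U w\<bar> < 1" if "w \<in> ball 0 1" for w
    unfolding U_def using that hermitian_le_norm[OF e(1), of w] by (intro strip_Cayley_bound) simp
  then have sub: "u ` ball 0 1 \<subseteq> lp_unit_ball p"
    by (auto simp: u_def lp_unit_ball_def lp_norm_axis[OF p])
  have "hermitian z e = of_real (norm z)"
  proof -
    have "z = of_real (norm z) *s e"
      using e(2) by (simp add: vec_eq_iff scaleR_conv_of_real[where 'a = complex])
    then have "hermitian z e = of_real (norm z) * hermitian e e" by (metis hermitian_smult)
    then show ?thesis by (simp add: hermitian_self e(1))
  qed
  then have "U z = 0"
    using z Im_strip_Cayley_of_real[of "norm z"] by (simp add: U_def)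
  then have u0: "lp_norm p (u z) = 0" by (simp add: u_def lp_norm_axis[OF p])
  have "ereal (4 / pi / (1 - (norm z)\<^sup>2)) \<le> grad_lp_norm p u z"
    unfolding u_def U_def using z by (intro extremal_grad_ge p e) auto
  then have "grad_lp_norm p u z = ereal (4 / pi * ((1 - (lp_norm p (u z))\<^sup>2) / (1 - (norm z)\<^sup>2)))"
    using Schwarz_Pick_lp_norm[OF assms u sub z] by (intro antisym) (simp_all add: u0)
  then show "\<exists>u :: complex ^ 'n \<Rightarrow> real ^ 'm.
            pluriharmonic_map_on (ball 0 1) u \<and> u ` ball 0 1 \<subseteq> lp_unit_ball p \<and>
            grad_lp_norm p u z
              = ereal (4 / pi * ((1 - (lp_norm p (u z))\<^sup>2) / (1 - (norm z)\<^sup>2)))"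
    using u sub by blast
qed

end
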